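(* Let $I=2$ and identify $p\in[0,1]$ with $(p,1-p)\in\Delta(2)$. Assume there exist continuous functions $h_1,h_2:[0,T]\to[0,1]$ with $h_1\le h_2$, $h_1$ decreasing and $h_2$ increasing, such that $$\mathrm{Vex}H(t,p)=H(t,p)\iff p\in[0,h_1(t)]\cup[h_2(t),1]$$ and $\frac{\partial^2H}{\partial p^2}(t,p)>0$ for all $(t,p)$ with $p\in[0,h_1(t))\cup(h_2(t),1]$. Let $(t_0,p_0)\in[0,T)\times[0,1]$ be an initial position. Then there is a unique optimal martingale measure $\bar{\mathbf P}$, i.e. a unique $\bar{\mathbf P}\in\mathbf M(t_0,p_0)$ attaining $\inf_{\mathbf P\in\mathbf M(t_0,p_0)}\mathbf E_{\mathbf P}[\int_{t_0}^TH(s,\mathbf p(s))ds]$. Under $\bar{\mathbf P}$ the process $\mathbf p$ is purely discontinuous and satisfies $$\mathbf p(t^-)=p_0\quad\forall t\in[t_0,t^*]\ \ \bar{\mathbf P}\text{-a.s., where } t^*=\inf\{t\ge t_0:\ p_0\in[h_1(t),h_2(t)]\},$$ and $$\mathbf p(t)\in\{h_1(t),h_2(t)\}\quad\forall t\in[t^*,T)\ \ \bar{\mathbf P}\text{-a.s.}$$ In particular, $$\bar{\mathbf P}\big[\mathbf p(t)=h_1(t)\,\big|\,\mathbf p(s)=h_1(s)\big]=\frac{h_2(t)-h_1(s)}{h_2(t)-h_1(t)}\qquad\forall\,t^*\le s\le t<T.$$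
   Context: Data. $T>0$, $U$ and $V$ are compact subsets of finite-dimensional spaces, $\ell_1,\ell_2:[0,T]\times U\times V\to\mathbb R$ are continuous, and Isaacs' condition is assumed: for all $(t,p)\in[0,T]\times[0,1]$, $$H(t,p):=\min_{u\in U}\max_{v\in V}\big(p\ell_1+(1-p)\ell_2\big)(t,u,v)=\max_{v\in V}\min_{u\in U}\big(p\ell_1+(1-p)\ell_2\big)(t,u,v).$$ $\mathrm{Vex}H(t,\cdot)$ is the convex hull of $H(t,\cdot)$, i.e. the largest convex function on $[0,1]$ below $H(t,\cdot)$. Increasing/decreasing are meant strictly. The infimum defining $t^*$ is taken over $t\in[t_0,T]$, with $t^*=T$ if the set is empty. The last formula is understood whenever the conditioning event has positive probability and $h_1(t)<h_2(t)$. Martingale measures. $\mathbf D(t_0)$ is the set of càdlàg functions $\mathbb R\to[0,1]$ (with $[0,1]\simeq\Delta(2)$) that are constant on $(-\infty,t_0)$ and on $[T,+\infty)$; $t\mapsto\mathbf p(t)$ is the coordinate process, with its generated filtration. $\mathbf M(t_0,p_0)$ is the set of probability measures $\mathbf P$ on $\mathbf D(t_0)$ under which $(\mathbf p(t))_{t\in\mathbb R}$ is a martingale and, $\mathbf P$-a.s., $\mathbf p(t)=p_0$ for $t<t_0$ and $\mathbf p(t)\in\{0,1\}$ for $t\ge T$. Purely discontinuous means that the continuous martingale part vanishes. *)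

theory Defs
  imports "HOL-Probability.Probability"
begin

definition hamiltonian ::
    "(real \<Rightarrow> 'u \<Rightarrow> 'v \<Rightarrow> real) \<Rightarrow> (real \<Rightarrow> 'u \<Rightarrow> 'v \<Rightarrow> real) \<Rightarrow> 'u set \<Rightarrow> 'v set \<Rightarrow> real \<Rightarrow> real \<Rightarrow> real" where
  "hamiltonian l1 l2 U V t p = (INF u\<in>U. SUP v\<in>V. p * l1 t u v + (1 - p) * l2 t u v)"

definition isaacs_condition ::
    "real \<Rightarrow> (real \<Rightarrow> 'u \<Rightarrow> 'v \<Rightarrow> real) \<Rightarrow> (real \<Rightarrow> 'u \<Rightarrow> 'v \<Rightarrow> real) \<Rightarrow> 'u set \<Rightarrow> 'v set \<Rightarrow> bool" where
  "isaacs_condition T l1 l2 U V \<longleftrightarrow>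
     (\<forall>t\<in>{0..T}. \<forall>p\<in>{0..1}.
        (INF u\<in>U. SUP v\<in>V. p * l1 t u v + (1 - p) * l2 t u v) =
        (SUP v\<in>V. INF u\<in>U. p * l1 t u v + (1 - p) * l2 t u v))"

definition Vex :: "(real \<Rightarrow> real) \<Rightarrow> real \<Rightarrow> real" where
  "Vex f p = (SUP g \<in> {g. convex_on {0..1} g \<and> (\<forall>q\<in>{0..1}. g q \<le> f q)}. g p)"

text \<open>For a function bounded below on the unit interval the supremum is a genuine one, and it is
  the largest convex minorant.\<close>

lemma Vex_largest:
  assumes bdd: "\<And>q. q \<in> {0..1} \<Longrightarrow> m \<le> f q"
  shows "convex_on {0..1} (Vex f)"
    and "q \<in> {0..1} \<Longrightarrow> Vex f q \<le> f q"
    and "\<lbrakk>convex_on {0..1} g; \<And>q. q \<in> {0..1} \<Longrightarrow> g q \<le> f q; q \<in> {0..1}\<rbrakk> \<Longrightarrow> g q \<le> Vex f q"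
proof -
  let ?G = "{g. convex_on {0..1} g \<and> (\<forall>q\<in>{0..1}. g q \<le> f q)}"
  have ne: "(\<lambda>_. m) \<in> ?G"
    using bdd by (simp add: convex_on_const)
  have above: "bdd_above ((\<lambda>g. g q) ` ?G)" if "q \<in> {0..1}" for q
    using that by (intro bdd_aboveI[of _ "f q"]) auto
  have ub: "g q \<le> Vex f q" if "g \<in> ?G" "q \<in> {0..1}" for g q
    unfolding Vex_def using that above by (intro cSUP_upper) auto
  show "Vex f q \<le> f q" if "q \<in> {0..1}" for q
    unfolding Vex_def using ne that by (intro cSUP_least) auto
  show "g q \<le> Vex f q"
    if "convex_on {0..1} g" "\<And>q. q \<in> {0..1} \<Longrightarrow> g q \<le> f q" "q \<in> {0..1}" for g q
    using ub[of g q] that by blast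
  show "convex_on {0..1} (Vex f)"
  proof (rule convex_onI)
    fix a x y :: real
    assume a: "0 < a" "a < 1" and xy: "x \<in> {0..1}" "y \<in> {0..1}"
    show "Vex f ((1 - a) *\<^sub>R x + a *\<^sub>R y) \<le> (1 - a) * Vex f x + a * Vex f y"
      unfolding Vex_def[of f "(1 - a) *\<^sub>R x + a *\<^sub>R y"]
    proof (rule cSUP_least)
      fix g assume g: "g \<in> ?G"
      have "g ((1 - a) *\<^sub>R x + a *\<^sub>R y) \<le> (1 - a) * g x + a * g y"
        using g a xy convex_onD[of "{0..1}" g a x y] by simp
      also have "\<dots> \<le> (1 - a) * Vex f x + a * Vex f y"
        using ub[OF g] a xy by (intro add_mono mult_left_mono) auto
      finally show "g ((1 - a) *\<^sub>R x + a *\<^sub>R y) \<le> (1 - a) * Vex f x + a * Vex f y" .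
    qed (use ne in blast)
  qed simp
qed

text \<open>Derivatives are taken relative to \<open>S\<close>, so they are one-sided at the end points when \<open>S\<close> is a
  closed interval. The first derivative is only required near \<open>p\<close>.\<close>

definition has_second_derivative_within ::
    "(real \<Rightarrow> real) \<Rightarrow> real \<Rightarrow> real \<Rightarrow> real set \<Rightarrow> bool" where
  "has_second_derivative_within f d p S \<longleftrightarrow>
     (\<exists>f'. (\<forall>\<^sub>F q in nhds p. q \<in> S \<longrightarrow> (f has_real_derivative f' q) (at q within S)) \<and>
           (f' has_real_derivative d) (at p within S))"

definition cadlag :: "(real \<Rightarrow> real) \<Rightarrow> bool" where
  "cadlag w \<longleftrightarrow> (\<forall>t. (w \<longlongrightarrow> w t) (at_right t) \<and> (\<exists>l. (w \<longlongrightarrow> l) (at_left t)))"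

definition path_space :: "real \<Rightarrow> real \<Rightarrow> (real \<Rightarrow> real) set" where
  "path_space T t0 =
     {w. cadlag w \<and> range w \<subseteq> {0..1} \<and> w constant_on {..<t0} \<and> w constant_on {T..}}"

text \<open>The \<open>\<sigma>\<close>-algebra on the path space generated by the coordinates at times in \<open>S\<close>.\<close>

definition coord_algebra :: "real \<Rightarrow> real \<Rightarrow> real set \<Rightarrow> (real \<Rightarrow> real) measure" where
  "coord_algebra T t0 S =
     sigma (path_space T t0) {(\<lambda>w. w s) -` A \<inter> path_space T t0 | s A. s \<in> S \<and> A \<in> sets borel}"

definition path_algebra :: "real \<Rightarrow> real \<Rightarrow> (real \<Rightarrow> real) measure" where
  "path_algebra T t0 = coord_algebra T t0 UNIV"

definition path_filtration :: "real \<Rightarrow> real \<Rightarrow> real \<Rightarrow> (real \<Rightarrow> real) measure" where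
  "path_filtration T t0 t = coord_algebra T t0 {..t}"

lemma space_coord_algebra [simp]: "space (coord_algebra T t0 S) = path_space T t0"
  unfolding coord_algebra_def by (rule space_measure_of) auto

lemma sets_coord_algebra:
  "sets (coord_algebra T t0 S) =
     sigma_sets (path_space T t0) {(\<lambda>w. w s) -` A \<inter> path_space T t0 | s A. s \<in> S \<and> A \<in> sets borel}"
  unfolding coord_algebra_def by (rule sets_measure_of) auto

lemma sets_coord_algebra_mono: "S \<subseteq> S' \<Longrightarrow> sets (coord_algebra T t0 S) \<subseteq> sets (coord_algebra T t0 S')"
  unfolding sets_coord_algebra by (rule sigma_sets_mono') blast

lemma measurable_coordinate: "s \<in> S \<Longrightarrow> (\<lambda>w. w s) \<in> borel_measurable (coord_algebra T t0 S)"
  by (rule measurableI) (auto simp: sets_coord_algebra intro!: sigma_sets.Basic)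

lemma filtration_path_filtration: "filtration (path_space T t0) (path_filtration T t0)"
proof
  show "space (path_filtration T t0 t) = path_space T t0" for t
    by (simp add: path_filtration_def)
  show "sets (path_filtration T t0 s) \<subseteq> sets (path_filtration T t0 t)" if "s \<le> t" for s t
    unfolding path_filtration_def using that by (intro sets_coord_algebra_mono) auto
qed

lemma subalgebra_path_filtration:
  assumes "sets P = sets (path_algebra T t0)"
  shows "subalgebra P (path_filtration T t0 t)"
  using assms sets_eq_imp_space_eq[OF assms] sets_coord_algebra_mono[of "{..t}" UNIV T t0]
  by (simp add: subalgebra_def path_filtration_def path_algebra_def)

definition is_martingale ::
    "'a measure \<Rightarrow> (real \<Rightarrow> 'a measure) \<Rightarrow> (real \<Rightarrow> 'a \<Rightarrow> real) \<Rightarrow> bool" where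
  "is_martingale P F X \<longleftrightarrow>
     (\<forall>t. X t \<in> borel_measurable (F t) \<and> integrable P (X t)) \<and>
     (\<forall>s t. s \<le> t \<longrightarrow> (AE w in P. real_cond_exp P (F s) (X t) w = X s w))"

definition martingale_measures :: "real \<Rightarrow> real \<Rightarrow> real \<Rightarrow> (real \<Rightarrow> real) measure set" where
  "martingale_measures T t0 p0 =
     {P. prob_space P \<and> sets P = sets (path_algebra T t0) \<and>
         is_martingale P (path_filtration T t0) (\<lambda>t w. w t) \<and>
         (AE w in P. (\<forall>t<t0. w t = p0) \<and> (\<forall>t\<ge>T. w t \<in> {0, 1}))}"

text \<open>The filtration is not completed, hence paths of continuous martingales are only required to
  be continuous almost surely. Every continuous martingale of the usual augmentation then has an
  indistinguishable version of this kind.\<close>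

definition continuous_L2_martingale ::
    "'a measure \<Rightarrow> (real \<Rightarrow> 'a measure) \<Rightarrow> real \<Rightarrow> (real \<Rightarrow> 'a \<Rightarrow> real) \<Rightarrow> bool" where
  "continuous_L2_martingale P F t0 N \<longleftrightarrow>
     is_martingale P F N \<and> (\<forall>t. integrable P (\<lambda>w. (N t w)\<^sup>2)) \<and>
     (AE w in P. continuous_on UNIV (\<lambda>t. N t w) \<and> (\<forall>t<t0. N t w = 0))"

text \<open>For a square-integrable martingale \<open>X\<close> that is deterministic before \<open>t0\<close>, the continuous
  martingale part is the (a.s. unique) continuous martingale \<open>C\<close> null before \<open>t0\<close> such that \<open>X - C\<close> is
  strongly orthogonal to all continuous martingales. The test martingales \<open>N\<close> vanish before \<open>t0\<close>,
  so the initial value of \<open>X\<close> need not be subtracted; a jump of \<open>X\<close> at \<open>t0\<close> counts as a jump.\<close>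

definition continuous_martingale_part ::
    "'a measure \<Rightarrow> (real \<Rightarrow> 'a measure) \<Rightarrow> real \<Rightarrow> (real \<Rightarrow> 'a \<Rightarrow> real) \<Rightarrow> (real \<Rightarrow> 'a \<Rightarrow> real) \<Rightarrow> bool" where
  "continuous_martingale_part P F t0 X C \<longleftrightarrow>
     continuous_L2_martingale P F t0 C \<and>
     (\<forall>N. continuous_L2_martingale P F t0 N \<longrightarrow>
          is_martingale P F (\<lambda>t w. (X t w - C t w) * N t w))"

definition purely_discontinuous ::
    "'a measure \<Rightarrow> (real \<Rightarrow> 'a measure) \<Rightarrow> real \<Rightarrow> (real \<Rightarrow> 'a \<Rightarrow> real) \<Rightarrow> bool" where
  "purely_discontinuous P F t0 X \<longleftrightarrow> continuous_martingale_part P F t0 X (\<lambda>t w. 0)"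

definition expected_cost ::
    "(real \<Rightarrow> real \<Rightarrow> real) \<Rightarrow> real \<Rightarrow> real \<Rightarrow> (real \<Rightarrow> real) measure \<Rightarrow> real" where
  "expected_cost H T t0 P = (\<integral>w. (LINT s:{t0..T}|lborel. H s (w s)) \<partial>P)"

definition optimal_martingale_measure ::
    "(real \<Rightarrow> real \<Rightarrow> real) \<Rightarrow> real \<Rightarrow> real \<Rightarrow> real \<Rightarrow> (real \<Rightarrow> real) measure \<Rightarrow> bool" where
  "optimal_martingale_measure H T t0 p0 P \<longleftrightarrow>
     P \<in> martingale_measures T t0 p0 \<and>
     (\<forall>Q\<in>martingale_measures T t0 p0. expected_cost H T t0 P \<le> expected_cost H T t0 Q)"

definition t_star :: "(real \<Rightarrow> real) \<Rightarrow> (real \<Rightarrow> real) \<Rightarrow> real \<Rightarrow> real \<Rightarrow> real \<Rightarrow> real" where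
  "t_star h1 h2 T t0 p0 =
     (let S = {t\<in>{t0..T}. p0 \<in> {h1 t..h2 t}} in if S = {} then T else Inf S)"

end

theory Submission
  imports Defs
begin

text \<open>Write \<open>a(t) \<le> p0 \<le> b(t)\<close> for the corridor equal to \<open>{p0}\<close> before \<open>t*\<close>, to \<open>[h1(t), h2(t)]\<close> on
  \<open>[t*, T)\<close> and to \<open>[0, 1]\<close> from \<open>T\<close> on; it only grows. For almost every time \<open>t\<close> some line stays below
  \<open>H(t, \<cdot>)\<close> and touches it exactly at \<open>a(t)\<close> and \<open>b(t)\<close>: the tangent at \<open>p0\<close>, or the chord over
  \<open>[h1(t), h2(t)]\<close>. As the process has mean \<open>p0\<close>, a martingale measure is optimal as soon as
  \<open>p(t) \<in> {a(t), b(t)}\<close> almost surely for every \<open>t\<close>, and once such a measure exists every optimal one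
  has this property.

  Existence: take independent uniform samples of \<open>[0, 1]\<close>, and let \<open>p(t)\<close> be \<open>a(t)\<close> if the first sample
  in \<open>[a(t), b(t)]\<close> exceeds \<open>p0\<close>, and \<open>b(t)\<close> otherwise. The first such sample changes finitely often
  away from the times where the corridor degenerates, and conditioning on the very first sample gives
  the martingale property. Uniqueness: on \<open>{a(t), b(t)}\<close> every function is affine, so the martingale
  property determines the finite-dimensional distributions. Pure discontinuity: the expected variation
  of \<open>p\<close> over any partition is at most twice the growth of the corridor, so the covariation with a
  continuous square-integrable martingale vanishes.\<close>

text \<open>The boundaries are only continuous and monotone, so the switching of the process need
  not have a rate, and if \<open>h1 t0 = h2 t0 = p0\<close> its jumps may accumulate at
  \<open>t0\<close>, which leaves no first jump to start from. Reading every time off one fixed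
  stream of samples avoids both difficulties. The crossed rule (a high sample gives the low state)
  comes from the mean: a uniform point of \<open>[a, b]\<close> exceeds \<open>p0\<close> with
  probability \<open>(b - p0) / (b - a)\<close>, the weight of \<open>a\<close> in the law on
  \<open>{a, b}\<close> with mean \<open>p0\<close>. Growth of the corridor makes this consistent in
  time: a sample inside stays inside, so the state can switch sides only when a sample of smaller
  index enters.

  Lines with the exact contact set are provided only strictly between \<open>t0\<close> and
  \<open>T\<close>: the boundaries may coincide at \<open>t0\<close>, and at \<open>T\<close> the
  corridor jumps to the whole unit interval. Optimality therefore yields the two-point property for
  almost every time first, and right continuity supplies the remaining times. The positive second
  derivative serves to exclude further contact points, and this exactness is what turns optimality
  into uniqueness.\<close>

section \<open>Sampling construction\<close>

text \<open>\<open>emeasure_stream_space\<close> uses the nonnegative integral. Passing to the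
  Bochner integral needs measurability in \<open>x\<close> of the section probabilities, seen by
  writing them as integrals of a jointly measurable indicator.\<close>

lemma (in prob_space) measure_stream_space_eq_integral:
  assumes A[measurable]: "A \<in> sets (stream_space M)"
  shows "measure (stream_space M) A =
    (\<integral>x. measure (stream_space M) {\<omega>\<in>space (stream_space M). x ## \<omega> \<in> A} \<partial>M)"
proof -
  interpret S: prob_space "stream_space M"
    by (rule prob_space_stream_space)
  have [measurable]: "{\<omega>\<in>space (stream_space M). x ## \<omega> \<in> A} \<in> sets (stream_space M)"
    if "x \<in> space M" for x
    using that by measurable
  have eq: "measure (stream_space M) {\<omega>\<in>space (stream_space M). x ## \<omega> \<in> A} =
      (\<integral>\<omega>. indicator A (x ## \<omega>) \<partial>stream_space M)" if "x \<in> space M" for x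
  proof -
    have "(\<integral>\<omega>. indicator A (x ## \<omega>) \<partial>stream_space M) =
        (\<integral>\<omega>. indicator {\<omega>\<in>space (stream_space M). x ## \<omega> \<in> A} \<omega> \<partial>stream_space M)"
      by (intro Bochner_Integration.integral_cong) (auto split: split_indicator)
    also have "\<dots> = measure (stream_space M) {\<omega>\<in>space (stream_space M). x ## \<omega> \<in> A}"
      by (simp add: Int_absorb2)
    finally show ?thesis ..
  qed
  have [measurable]: "(\<lambda>x. measure (stream_space M) {\<omega>\<in>space (stream_space M). x ## \<omega> \<in> A}) \<in> borel_measurable M"
    by (subst measurable_cong[OF eq]) measurable
  have "ennreal (measure (stream_space M) A) =
      (\<integral>\<^sup>+x. ennreal (measure (stream_space M) {\<omega>\<in>space (stream_space M). x ## \<omega> \<in> A}) \<partial>M)"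
    using emeasure_stream_space[OF A] by (simp add: S.emeasure_eq_measure)
  moreover have "integrable M (\<lambda>x. measure (stream_space M) {\<omega>\<in>space (stream_space M). x ## \<omega> \<in> A})"
    by (rule integrable_const_bound[of _ 1]) auto
  ultimately show ?thesis
    by (simp add: nn_integral_eq_integral integral_nonneg_AE)
qed

abbreviation unif :: "real measure" where
  "unif \<equiv> uniform_measure lborel {0..1}"

abbreviation samples :: "real stream measure" where
  "samples \<equiv> stream_space unif"

lemma prob_space_unif: "prob_space unif"
  by (rule prob_space_uniform_measure) auto

lemma prob_space_samples: "prob_space samples"
  by (rule prob_space.prob_space_stream_space[OF prob_space_unif])

lemma space_samples [simp]: "space samples = UNIV"
  by (simp add: space_stream_space)

lemma measure_unif_interval:
  assumes "0 \<le> c" "c \<le> d" "d \<le> 1"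
  shows "measure unif {c..d} = d - c" "measure unif {c<..d} = d - c"
proof -
  have "{0..1} \<inter> {c..d} = {c..d}" "{0..1} \<inter> {c<..d} = {c<..d}"
    using assms by auto
  then show "measure unif {c..d} = d - c" "measure unif {c<..d} = d - c"
    using assms by (simp_all add: measure_uniform_measure)
qed

lemma measure_samples:
  assumes "A \<in> sets samples"
  shows "measure samples A = (\<integral>x. measure samples {\<omega>. x ## \<omega> \<in> A} \<partial>unif)"
  using prob_space.measure_stream_space_eq_integral[OF prob_space_unif assms] by simp

text \<open>Asking for infinitely many hits makes the property invariant under prepending a sample.\<close>

definition rich :: "real stream \<Rightarrow> bool" where
  "rich \<omega> \<longleftrightarrow> (\<forall>q r::rat. 0 \<le> q \<and> q < r \<and> r \<le> 1 \<longrightarrow>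
    (\<forall>n. \<exists>k\<ge>n. \<omega> !! k \<in> {real_of_rat q..real_of_rat r}))"

lemma rich_Stream [simp]: "rich (x ## \<omega>) \<longleftrightarrow> rich \<omega>"
proof -
  have "(\<forall>n. \<exists>k\<ge>n. (x ## \<omega>) !! k \<in> A) \<longleftrightarrow> (\<forall>n. \<exists>k\<ge>n. \<omega> !! k \<in> A)" for A
  proof safe
    fix n assume "\<forall>n. \<exists>k\<ge>n. (x ## \<omega>) !! k \<in> A"
    then obtain k where "k \<ge> Suc n" "(x ## \<omega>) !! k \<in> A" by blast
    then show "\<exists>k\<ge>n. \<omega> !! k \<in> A"
      by (cases k) auto
  next
    fix n assume "\<forall>n. \<exists>k\<ge>n. \<omega> !! k \<in> A"
    then obtain k where "k \<ge> n" "\<omega> !! k \<in> A" by blast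
    then show "\<exists>k\<ge>n. (x ## \<omega>) !! k \<in> A"
      by (intro exI[of _ "Suc k"]) auto
  qed
  from this[of "{_.._}"] show ?thesis
    unfolding rich_def by simp
qed

lemma samples_nth_measurable [measurable]: "(\<lambda>\<omega>. \<omega> !! n) \<in> borel_measurable samples"
  using measurable_snth[of n unif] by simp

lemma Stream_measurable_samples [measurable]: "(\<lambda>\<omega>. x ## \<omega>) \<in> measurable samples samples"
  by (rule measurable_Stream) auto

lemma rich_measurable [measurable]: "Measurable.pred samples rich"
  unfolding rich_def by measurable

text \<open>Conditioning on the first sample, the probability c of never hitting
  \<open>{q..r}\<close> satisfies c = c (1 - (r - q)), so c = 0. Prepending samples moves this to
  the hits after any index, and rational end points leave countably many conditions.\<close>

lemma AE_rich: "AE \<omega> in samples. rich \<omega>"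
proof -
  interpret S: prob_space samples by (rule prob_space_samples)
  interpret U: prob_space unif by (rule prob_space_unif)
  have *: "AE \<omega> in samples. \<exists>k\<ge>n. \<omega> !! k \<in> {q..r}"
    if qr: "0 \<le> q" "q < r" "r \<le> 1" for q r n
  proof -
    let ?N = "\<lambda>n. {\<omega>. \<forall>k\<ge>n. \<omega> !! k \<notin> {q..r}}"
    have N[measurable]: "?N n \<in> sets samples" for n
    proof -
      have "{\<omega>\<in>space samples. \<forall>k\<ge>n. \<omega> !! k \<notin> {q..r}} \<in> sets samples"
        by measurable
      then show ?thesis by simp
    qed
    have "S.prob (?N n) = 0"
    proof (induction n)
      case 0
      have "{\<omega>. x ## \<omega> \<in> ?N 0} = (if x \<in> {q..r} then {} else ?N 0)" for x
        by (auto simp: Stream_snth split: nat.splits)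
      then have "S.prob (?N 0) = (\<integral>x. S.prob (?N 0) * (1 - indicator {q..r} x) \<partial>unif)"
        by (subst measure_samples[OF N], intro Bochner_Integration.integral_cong)
          (auto split: split_indicator)
      also have "\<dots> = S.prob (?N 0) * (1 - (r - q))"
        using qr by (subst integral_mult_right_zero, subst Bochner_Integration.integral_diff)
          (auto simp: measure_unif_interval U.prob_space U.emeasure_eq_measure)
      finally show ?case
        using qr by (simp add: algebra_simps)
    next
      case (Suc n)
      have "{\<omega>. x ## \<omega> \<in> ?N (Suc n)} = ?N n" for x
        by (auto simp: Stream_snth split: nat.splits) 
      then show ?case
        using measure_samples[OF N[of "Suc n"]] Suc by simp
    qed
    then have "AE \<omega> in samples. \<omega> \<notin> ?N n"
      using S.prob_eq_0[OF N] by simp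
    then show ?thesis
      by eventually_elim auto
  qed
  have "AE \<omega> in samples. 0 \<le> q \<and> q < r \<and> r \<le> 1 \<longrightarrow>
      (\<forall>n. \<exists>k\<ge>n. \<omega> !! k \<in> {real_of_rat q..real_of_rat r})" for q r :: rat
  proof (cases "0 \<le> q \<and> q < r \<and> r \<le> 1")
    case True
    then show ?thesis
      using *[of "of_rat q" "of_rat r"]
      by (simp add: AE_all_countable of_rat_less del: atLeastAtMost_iff)
  next
    case False
    then show ?thesis by (intro AE_I2) blast
  qed
  then show ?thesis
    unfolding rich_def by (simp add: AE_all_countable del: atLeastAtMost_iff)
qed

section \<open>Growing corridors and the paths sampled in them\<close>

locale corridor =
  fixes a b :: "real \<Rightarrow> real" and p0 :: real
  assumes a_antimono: "s \<le> t \<Longrightarrow> a t \<le> a s"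
    and b_mono: "s \<le> t \<Longrightarrow> b s \<le> b t"
    and a_le: "a t \<le> p0" and le_b: "p0 \<le> b t"
    and a_nonneg: "0 \<le> a t" and b_le_1: "b t \<le> 1"
    and a_right: "(a \<longlongrightarrow> a t) (at_right t)"
    and b_right: "(b \<longlongrightarrow> b t) (at_right t)"
begin

lemma a_le_b: "a t \<le> b t"
  using a_le le_b order_trans by blast

text \<open>A sample outside \<open>[a s, b s]\<close> but above \<open>p0\<close> enters the growing corridor through its upper
  boundary, and then the martingale property requires the lower state.\<close>

definition low :: "real \<Rightarrow> real stream \<Rightarrow> bool" where
  "low t \<omega> \<longleftrightarrow> (\<exists>k. \<omega> !! k \<in> {a t..b t} \<and> p0 < \<omega> !! k \<and> (\<forall>j<k. \<omega> !! j \<notin> {a t..b t}))"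

text \<open>The constant value on the null set of streams that are not rich only serves to keep all paths in
  the path space.\<close>

definition path :: "real stream \<Rightarrow> real \<Rightarrow> real" where
  "path \<omega> t = (if rich \<omega> then if low t \<omega> then a t else b t else p0)"

lemma low_Stream:
  "low t (x ## \<omega>) \<longleftrightarrow> (if x \<in> {a t..b t} then p0 < x else low t \<omega>)"
proof (cases "x \<in> {a t..b t}")
  case True
  have "low t (x ## \<omega>) \<longleftrightarrow> p0 < x"
  proof
    assume "low t (x ## \<omega>)"
    then obtain k where k: "p0 < (x ## \<omega>) !! k" "\<forall>j<k. (x ## \<omega>) !! j \<notin> {a t..b t}"
      by (auto simp: low_def)
    with True have "k = 0"
      by (metis gr0I snth.simps(1) stream.sel(1))
    with k show "p0 < x" by simp
  next
    assume "p0 < x" with True show "low t (x ## \<omega>)"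
      unfolding low_def by (intro exI[of _ 0]) auto
  qed
  with True show ?thesis by simp
next
  case False
  have "low t (x ## \<omega>) \<longleftrightarrow> low t \<omega>"
  proof
    assume "low t (x ## \<omega>)"
    then obtain k where k: "(x ## \<omega>) !! k \<in> {a t..b t}" "p0 < (x ## \<omega>) !! k"
        "\<forall>j<k. (x ## \<omega>) !! j \<notin> {a t..b t}"
      by (auto simp: low_def)
    with False obtain k' where k': "k = Suc k'"
      by (cases k) auto
    with k(3) have "\<forall>j<k'. \<omega> !! j \<notin> {a t..b t}"
      by (metis Suc_less_eq snth_Stream)
    with k k' show "low t \<omega>"
      unfolding low_def by (intro exI[of _ k']) auto
  next
    assume "low t \<omega>"
    then obtain k where k: "\<omega> !! k \<in> {a t..b t}" "p0 < \<omega> !! k" "\<forall>j<k. \<omega> !! j \<notin> {a t..b t}"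
      by (auto simp: low_def)
    then have "\<forall>j<Suc k. (x ## \<omega>) !! j \<notin> {a t..b t}"
      using False by (auto simp: Stream_snth split: nat.splits)
    with k show "low t (x ## \<omega>)"
      unfolding low_def by (intro exI[of _ "Suc k"]) auto
  qed
  with False show ?thesis by auto
qed

lemma low_measurable [measurable]: "Measurable.pred samples (low t)"
  unfolding low_def by measurable

lemma path_measurable [measurable]: "(\<lambda>\<omega>. path \<omega> t) \<in> borel_measurable samples"
  unfolding path_def by measurable

text \<open>A sample that misses the corridor at time \<open>s\<close> also misses the narrower ones
  before, so the whole path up to \<open>s\<close> ignores it. This is the source of the invariance
  required in \<open>measure_low_Int\<close>.\<close>

lemma path_Stream:
  assumes "r \<le> s" "x \<notin> {a s..b s}"
  shows "path (x ## \<omega>) r = path \<omega> r"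
proof -
  have "x \<notin> {a r..b r}"
    using assms a_antimono[OF assms(1)] b_mono[OF assms(1)] by auto
  then have "low r (x ## \<omega>) \<longleftrightarrow> low r \<omega>"
    by (subst low_Stream) auto
  then show ?thesis
    by (simp add: path_def)
qed

text \<open>Conditioning on the first sample: it either misses the corridor at time \<open>t\<close>, or lands in it
  outside the corridor at time \<open>s\<close> and so decides the state at time \<open>t\<close> independently of \<open>B\<close>, or
  lands in the corridor at time \<open>s\<close>, where the states at \<open>s\<close> and \<open>t\<close> agree.\<close>

lemma measure_low_Int:
  assumes st: "s \<le> t" and B[measurable]: "B \<in> sets samples"
    and inv: "\<And>x \<omega>. x \<notin> {a s..b s} \<Longrightarrow> x ## \<omega> \<in> B \<longleftrightarrow> \<omega> \<in> B"
  shows "(b t - a t) * measure samples ({\<omega>. low t \<omega>} \<inter> B) =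
    (b t - b s) * measure samples B + (b s - a s) * measure samples ({\<omega>. low s \<omega>} \<inter> B)"
proof -
  interpret S: prob_space samples by (rule prob_space_samples)
  interpret U: prob_space unif by (rule prob_space_unif)
  let ?A = "\<lambda>t. S.prob ({\<omega>. low t \<omega>} \<inter> B)"
  let ?I = "\<lambda>t. indicator {a t..b t} :: real \<Rightarrow> real"
  have L[measurable]: "{\<omega>. low t \<omega>} \<in> sets samples" for t
    using low_measurable[of t] by (simp add: pred_def)
  let ?D = "\<lambda>t x. S.prob {\<omega>. x ## \<omega> \<in> {\<omega>. low t \<omega>} \<inter> B}"
  note ab = a_antimono[OF st] b_mono[OF st]
  have int: "integrable unif (?D t)" for t
  proof (rule U.integrable_const_bound[of _ 1])
    have "?D t = (\<lambda>x. \<integral>\<omega>. indicator ({\<omega>. low t \<omega>} \<inter> B) (x ## \<omega>) \<partial>samples)"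
    proof
      fix x
      have "{\<omega>\<in>space samples. x ## \<omega> \<in> {\<omega>. low t \<omega>} \<inter> B} \<in> sets samples"
        by measurable
      then have "?D t x = (\<integral>\<omega>. indicator {\<omega>. x ## \<omega> \<in> {\<omega>. low t \<omega>} \<inter> B} \<omega> \<partial>samples)"
        by simp
      also have "\<dots> = (\<integral>\<omega>. indicator ({\<omega>. low t \<omega>} \<inter> B) (x ## \<omega>) \<partial>samples)"
        by (intro Bochner_Integration.integral_cong) (auto split: split_indicator)
      finally show "?D t x = (\<integral>\<omega>. indicator ({\<omega>. low t \<omega>} \<inter> B) (x ## \<omega>) \<partial>samples)" .
    qed
    then show "?D t \<in> borel_measurable unif"
      by simp
  qed auto
  \<comment> \<open>A sample missing both corridors keeps both values. One in the gap keeps the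
    value at \<open>s\<close>, while the value at \<open>t\<close> becomes that of \<open>B\<close>
    above \<open>b s\<close> and 0 below \<open>a s\<close>. One in the narrower corridor makes both
    values equal.\<close>
  have D: "?D t x - ?D s x = (?A t - ?A s) * (1 - ?I t x) + S.prob B * indicator {b s<..b t} x
      - ?A s * (?I t x - ?I s x)" for x
  proof -
    consider "x \<notin> {a t..b t}" "x \<notin> {a s..b s}" | "x \<in> {a t..b t}" "x \<notin> {a s..b s}" "b s < x"
      | "x \<in> {a t..b t}" "x \<notin> {a s..b s}" "x < a s" | "x \<in> {a s..b s}" "x \<in> {a t..b t}"
      using ab by fastforce
    then show ?thesis
    proof cases
      case 1
      then have "{\<omega>. x ## \<omega> \<in> {\<omega>. low r \<omega>} \<inter> B} = {\<omega>. low r \<omega>} \<inter> B" if "r \<in> {s, t}" for r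
        using that inv by (auto simp: low_Stream)
      with 1 show ?thesis
        using ab a_le_b[of s] by (auto simp: indicator_def)
    next
      case 2
      then have "p0 < x" using le_b[of s] by auto
      with 2 have "{\<omega>. x ## \<omega> \<in> {\<omega>. low t \<omega>} \<inter> B} = B"
        "{\<omega>. x ## \<omega> \<in> {\<omega>. low s \<omega>} \<inter> B} = {\<omega>. low s \<omega>} \<inter> B"
        using inv by (auto simp: low_Stream)
      moreover have "x \<le> b t" using 2 by auto
      ultimately show ?thesis
        using 2 by (auto simp: indicator_def)
    next
      case 3
      then have "\<not> p0 < x" using a_le[of s] by auto
      with 3 have *: "{\<omega>. x ## \<omega> \<in> {\<omega>. low t \<omega>} \<inter> B} = {}"
        "{\<omega>. x ## \<omega> \<in> {\<omega>. low s \<omega>} \<inter> B} = {\<omega>. low s \<omega>} \<inter> B"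
        using inv by (auto simp: low_Stream)
      show ?thesis
        unfolding * using 3 a_le_b[of s] by (auto simp: indicator_def)
    next
      case 4
      then have "{\<omega>. x ## \<omega> \<in> {\<omega>. low t \<omega>} \<inter> B} = {\<omega>. x ## \<omega> \<in> {\<omega>. low s \<omega>} \<inter> B}"
        by (auto simp: low_Stream)
      with 4 show ?thesis by simp
    qed
  qed
  have "?A t - ?A s = (\<integral>x. ?D t x - ?D s x \<partial>unif)"
    by (subst Bochner_Integration.integral_diff[OF int int]) (simp only: measure_samples[OF sets.Int[OF L B]])
  \<comment> \<open>The unknown difference reappears because a miss of the wider corridor changes
    nothing; moving it to the other side leaves the factor \<open>b t - a t\<close>.\<close>
  also have "\<dots> = (?A t - ?A s) * (1 - (b t - a t)) + S.prob B * (b t - b s)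
      - ?A s * ((b t - a t) - (b s - a s))"
  proof -
    have I: "(\<integral>x. ?I r x \<partial>unif) = b r - a r" "integrable unif (?I r)" for r
      using a_nonneg[of r] b_le_1[of r] a_le_b[of r]
      by (auto simp: measure_unif_interval U.emeasure_eq_measure)
    have J: "(\<integral>x. indicator {b s<..b t} x \<partial>unif) = b t - b s"
      "integrable unif (indicator {b s<..b t} :: real \<Rightarrow> real)"
      using a_nonneg[of s] a_le_b[of s] b_le_1[of t] ab
      by (auto simp: measure_unif_interval U.emeasure_eq_measure simp del: measure_uniform_measure)
    show ?thesis
      unfolding D using I J by (simp add: U.prob_space)
  qed
  finally show ?thesis
    by (simp add: algebra_simps)
qed

lemma path_bounds: "path \<omega> t \<in> {a t..b t}"
  using a_le[of t] le_b[of t] a_le_b[of t] by (auto simp: path_def)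

lemma path_collapsed: "a t = b t \<Longrightarrow> path \<omega> t = p0"
  using a_le[of t] le_b[of t] by (auto simp: path_def)

lemma rich_hits:
  assumes "rich \<omega>" "a t < b t"
  shows "\<exists>k. \<omega> !! k \<in> {a t..b t}"
proof -
  obtain q where q: "a t < of_rat q" "of_rat q < b t"
    using of_rat_dense[OF assms(2)] by blast
  obtain r where r: "real_of_rat q < of_rat r" "of_rat r < b t"
    using of_rat_dense[OF q(2)] by blast
  have "0 \<le> real_of_rat q" "real_of_rat r \<le> 1"
    using a_nonneg[of t] b_le_1[of t] q r by linarith+
  then have "0 \<le> q" "q < r" "r \<le> 1"
    using r(1) by (simp_all add: of_rat_less)
  with assms(1) obtain k where "\<omega> !! k \<in> {real_of_rat q..real_of_rat r}"
    unfolding rich_def by blast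
  with q r show ?thesis
    by (intro exI[of _ k]) auto
qed

lemma low_iff_first:
  assumes "\<omega> !! k \<in> {a t..b t}" "\<And>j. j < k \<Longrightarrow> \<omega> !! j \<notin> {a t..b t}"
  shows "low t \<omega> \<longleftrightarrow> p0 < \<omega> !! k"
proof
  assume "low t \<omega>"
  then obtain i where i: "\<omega> !! i \<in> {a t..b t}" "p0 < \<omega> !! i" "\<forall>j<i. \<omega> !! j \<notin> {a t..b t}"
    by (auto simp: low_def)
  with assms have "i = k" by (metis linorder_neqE_nat)
  with i show "p0 < \<omega> !! k" by simp
qed (use assms in \<open>auto simp: low_def\<close>)

text \<open>The samples before the first hit are finitely many and lie outside a closed interval
  with right-continuous ends, so they stay outside for a while after \<open>t\<close>, and the first
  hit keeps its index. A collapsed corridor squeezes the path instead.\<close>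

lemma path_right:
  "(path \<omega> \<longlongrightarrow> path \<omega> t) (at_right t)"
proof (cases "rich \<omega>")
  case False
  then have "path \<omega> = (\<lambda>_. p0)" by (auto simp: path_def)
  then show ?thesis by simp
next
  case True
  show ?thesis
  proof (cases "a t = b t")
    case eq: True
    have "a t = p0" "b t = p0"
      using eq a_le[of t] le_b[of t] by auto
    moreover have "(path \<omega> \<longlongrightarrow> p0) (at_right t)"
    proof (rule tendsto_sandwich)
      show "(a \<longlongrightarrow> p0) (at_right t)" "(b \<longlongrightarrow> p0) (at_right t)"
        using a_right[of t] b_right[of t] \<open>a t = p0\<close> \<open>b t = p0\<close> by simp_all
      show "\<forall>\<^sub>F x in at_right t. a x \<le> path \<omega> x" "\<forall>\<^sub>F x in at_right t. path \<omega> x \<le> b x"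
        using path_bounds by auto
    qed
    ultimately show ?thesis
      using eq by (simp add: path_collapsed)
  next
    case False
    then have lt: "a t < b t" using a_le_b[of t] by simp
    define k where "k = (LEAST k. \<omega> !! k \<in> {a t..b t})"
    have k: "\<omega> !! k \<in> {a t..b t}"
      unfolding k_def using rich_hits[OF True lt] by (rule LeastI_ex)
    have less: "\<omega> !! j \<notin> {a t..b t}" if "j < k" for j
      using that not_less_Least unfolding k_def by blast
    have "\<forall>\<^sub>F r in at_right t. \<omega> !! j \<notin> {a r..b r}" if jk: "j < k" for j
    proof -
      consider "\<omega> !! j < a t" | "b t < \<omega> !! j"
        using less[OF jk] by fastforce
      then show ?thesis
      proof cases
        case 1
        from order_tendstoD(1)[OF a_right 1] show ?thesis
          by eventually_elim auto
      next
        case 2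
        from order_tendstoD(2)[OF b_right 2] show ?thesis
          by eventually_elim auto
      qed
    qed
    then have "\<forall>\<^sub>F r in at_right t. \<forall>j\<in>{..<k}. \<omega> !! j \<notin> {a r..b r}"
      by (intro eventually_ball_finite) auto
    moreover have "\<forall>\<^sub>F r in at_right t. t < r"
      by (simp add: eventually_at_filter)
    ultimately have "\<forall>\<^sub>F r in at_right t. path \<omega> r = (if low t \<omega> then a r else b r)"
    proof eventually_elim
      case (elim r)
      have "\<omega> !! k \<in> {a r..b r}"
        using k a_antimono[of t r] b_mono[of t r] elim by auto
      then have "low r \<omega> \<longleftrightarrow> p0 < \<omega> !! k"
        using elim by (intro low_iff_first) auto
      moreover have "low t \<omega> \<longleftrightarrow> p0 < \<omega> !! k"
        using k less by (intro low_iff_first) auto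
      ultimately show ?case using True by (simp add: path_def)
    qed
    moreover have "((\<lambda>r. if low t \<omega> then a r else b r) \<longlongrightarrow> path \<omega> t) (at_right t)"
      using a_right[of t] b_right[of t] True by (simp add: path_def)
    ultimately show ?thesis
      by (subst tendsto_cong)
  qed
qed

lemma b_left: "\<exists>l. (b \<longlongrightarrow> l) (at_left t)"
proof -
  have bdd: "bdd_above (b ` {..<t})"
    using b_le_1 by (intro bdd_aboveI[of _ 1]) auto
  have ne: "{..<t} \<noteq> {}" by simp
  have "(b \<longlongrightarrow> (SUP s\<in>{..<t}. b s)) (at_left t)"
  proof (rule order_tendstoI)
    fix y assume "y < (SUP s\<in>{..<t}. b s)"
    then obtain s where s: "s < t" "y < b s"
      using less_cSUP_iff[OF ne bdd] by auto
    have "\<forall>\<^sub>F r in at_left t. r \<in> {s<..<t}"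
      by (rule eventually_at_left_real[OF s(1)])
    then show "\<forall>\<^sub>F r in at_left t. y < b r"
    proof eventually_elim
      case (elim r) then show ?case using s b_mono[of s r] by auto
    qed
  next
    fix y assume y: "(SUP s\<in>{..<t}. b s) < y"
    have "\<forall>\<^sub>F r in at_left t. r < t"
      by (simp add: eventually_at_filter)
    then show "\<forall>\<^sub>F r in at_left t. b r < y"
    proof eventually_elim
      case (elim r) then show ?case
        using cSUP_upper[OF _ bdd, of r] y by auto
    qed
  qed
  then show ?thesis ..
qed

lemma a_left: "\<exists>l. (a \<longlongrightarrow> l) (at_left t)"
proof -
  \<comment> \<open>The reflection x -> 1 - x exchanges the two boundaries, so the result for
    \<open>b\<close> applies to \<open>a\<close>.\<close>
  interpret m: corridor "\<lambda>t. 1 - b t" "\<lambda>t. 1 - a t" "1 - p0"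
    by standard (auto simp: a_antimono b_mono a_le le_b a_nonneg b_le_1 intro!: tendsto_diff a_right b_right)
  obtain l where "((\<lambda>t. 1 - a t) \<longlongrightarrow> l) (at_left t)"
    using m.b_left by blast
  from tendsto_diff[OF tendsto_const[of 1] this] show ?thesis
    by auto
qed

text \<open>The relevant index is the least one that hits at some time strictly before
  \<open>t\<close>: it stays inside from then on and no smaller index ever interferes before
  \<open>t\<close>, so the path follows one boundary up to \<open>t\<close>. A sample entering only
  at \<open>t\<close> has no influence on the left limit.\<close>

lemma path_left: "\<exists>l. (path \<omega> \<longlongrightarrow> l) (at_left t)"
proof (cases "rich \<omega> \<and> (\<exists>s<t. a s < b s)")
  case False
  have "\<forall>\<^sub>F r in at_left t. r < t"
    by (simp add: eventually_at_filter)
  then have "\<forall>\<^sub>F r in at_left t. path \<omega> r = p0"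
  proof eventually_elim
    case (elim r)
    with False have "\<not> rich \<omega> \<or> a r = b r"
      using a_le_b[of r] by auto
    then show ?case using path_collapsed[of r \<omega>] by (cases "rich \<omega>") (simp_all add: path_def)
  qed
  from tendsto_eventually[OF this] show ?thesis by blast
next
  case True
  then obtain s0 where s0: "s0 < t" "a s0 < b s0" and rich: "rich \<omega>" by blast
  let ?hit = "\<lambda>k. \<exists>s\<in>{s0..<t}. \<omega> !! k \<in> {a s..b s}"
  define k where "k = (LEAST k. ?hit k)"
  have "\<exists>k. ?hit k"
  proof -
    obtain k where "\<omega> !! k \<in> {a s0..b s0}"
      using rich_hits[OF rich s0(2)] by blast
    with s0(1) show ?thesis
      by (intro exI[of _ k] bexI[of _ s0]) auto
  qed
  then have "?hit k" unfolding k_def by (rule LeastI_ex)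
  then obtain s where s: "s0 \<le> s" "s < t" "\<omega> !! k \<in> {a s..b s}" by auto
  have less: "\<not> ?hit j" if "j < k" for j
    using that not_less_Least unfolding k_def by blast
  have "\<forall>\<^sub>F r in at_left t. r \<in> {s<..<t}"
    by (rule eventually_at_left_real[OF s(2)])
  then have *: "\<forall>\<^sub>F r in at_left t. path \<omega> r = (if p0 < \<omega> !! k then a r else b r)"
  proof eventually_elim
    case (elim r)
    have "\<omega> !! k \<in> {a r..b r}"
      using s a_antimono[of s r] b_mono[of s r] elim by auto
    moreover have "\<omega> !! j \<notin> {a r..b r}" if "j < k" for j
      using less[OF that] elim s by auto
    ultimately have "low r \<omega> \<longleftrightarrow> p0 < \<omega> !! k"
      by (rule low_iff_first)
    then show ?case using rich by (simp add: path_def)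
  qed
  obtain l l' where "(a \<longlongrightarrow> l) (at_left t)" "(b \<longlongrightarrow> l') (at_left t)"
    using a_left b_left by blast
  then have "((\<lambda>r. if p0 < \<omega> !! k then a r else b r) \<longlongrightarrow> (if p0 < \<omega> !! k then l else l')) (at_left t)"
    by simp
  with * show ?thesis
    using tendsto_cong[OF *] by blast
qed

lemma cadlag_path: "cadlag (path \<omega>)"
  unfolding cadlag_def using path_right path_left by blast

end


section \<open>Martingales on the path space\<close>

text \<open>Generators cannot separate paths that agree on \<open>S\<close>, and this survives
  complements and countable unions. It makes an event of the past insensitive to samples outside the
  current corridor.\<close>

lemma coord_algebra_determined:
  assumes "B \<in> sets (coord_algebra T t0 S)"
    and "w \<in> path_space T t0" "w' \<in> path_space T t0" "\<And>s. s \<in> S \<Longrightarrow> w s = w' s"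
  shows "w \<in> B \<longleftrightarrow> w' \<in> B"
  using assms(1) unfolding sets_coord_algebra
  by (induction rule: sigma_sets.induct) (use assms in auto)

lemma is_martingaleI:
  assumes "prob_space P" "\<And>t. subalgebra P (F t)"
    and meas: "\<And>t. X t \<in> borel_measurable (F t)" and int: "\<And>t. integrable P (X t)"
    and eq: "\<And>s t B. \<lbrakk>s \<le> t; B \<in> sets (F s)\<rbrakk> \<Longrightarrow>
      (\<integral>w. indicator B w * X t w \<partial>P) = (\<integral>w. indicator B w * X s w \<partial>P)"
  shows "is_martingale P F X"
  unfolding is_martingale_def
proof (intro conjI allI impI meas int)
  fix s t :: real assume st: "s \<le> t"
  interpret prob_space P by fact
  interpret finite_measure_subalgebra P "F s"
    by standard (rule assms(2))
  show "AE w in P. real_cond_exp P (F s) (X t) w = X s w"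
    by (rule real_cond_exp_charact)
      (use eq[OF st] in \<open>auto simp: set_lebesgue_integral_def intro: int meas\<close>)
qed

lemma is_martingale_integral:
  assumes "prob_space P" "subalgebra P (F s)" "is_martingale P F X" "s \<le> t"
    and f: "f \<in> borel_measurable (F s)" and int: "integrable P (\<lambda>w. f w * X t w)"
  shows "integrable P (\<lambda>w. f w * X s w)"
    and "(\<integral>w. f w * X t w \<partial>P) = (\<integral>w. f w * X s w \<partial>P)"
proof -
  interpret prob_space P by fact
  interpret finite_measure_subalgebra P "F s"
    by standard (rule assms(2))
  have X: "X t \<in> borel_measurable P" "X s \<in> borel_measurable P"
    and ae: "AE w in P. real_cond_exp P (F s) (X t) w = X s w"
    using assms(3,4) by (auto simp: is_martingale_def)
  have f': "f \<in> borel_measurable P"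
    by (rule measurable_from_subalg[OF subalg f])
  have eq: "AE w in P. f w * real_cond_exp P (F s) (X t) w = f w * X s w"
    using ae by eventually_elim simp
  note [measurable] = X f'
  have [measurable]: "real_cond_exp P (F s) (X t) \<in> borel_measurable P"
    by (rule borel_measurable_cond_exp2)
  show "integrable P (\<lambda>w. f w * X s w)"
    using real_cond_exp_intg(1)[OF int f X(1)]
    by (rule integrable_cong_AE_imp) (use eq in auto)
  have "(\<integral>w. f w * X t w \<partial>P) = (\<integral>w. f w * real_cond_exp P (F s) (X t) w \<partial>P)"
    using real_cond_exp_intg(2)[OF int f X(1)] by simp
  also have "\<dots> = (\<integral>w. f w * X s w \<partial>P)"
    by (rule integral_cong_AE) (use eq in auto)
  finally show "(\<integral>w. f w * X t w \<partial>P) = (\<integral>w. f w * X s w \<partial>P)" .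
qed

text \<open>Under these conditions the two-point property contains the boundary conditions of
  \<open>martingale_measures\<close>: the value \<open>p0\<close> before \<open>t0\<close> and a
  value in \<open>{0, 1}\<close> from \<open>T\<close> on.\<close>

locale terminal_corridor = corridor +
  fixes T t0 :: real
  assumes initial: "t < t0 \<Longrightarrow> a t = b t"
    and terminal: "T \<le> t \<Longrightarrow> a t = 0" "T \<le> t \<Longrightarrow> b t = 1"
begin

lemma ab_initial: "t < t0 \<Longrightarrow> a t = p0" "t < t0 \<Longrightarrow> b t = p0"
  using initial[of t] a_le[of t] le_b[of t] by linarith+

lemma path_in_path_space: "path \<omega> \<in> path_space T t0"
proof -
  have "path \<omega> t = path \<omega> T" if "T \<le> t" for t
  proof -
    have "a t = a T" "b t = b T"
      using terminal[of t] terminal[of T] that by auto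
    then show ?thesis
      by (simp only: path_def low_def)
  qed
  then have "path \<omega> constant_on {T..}"
    unfolding constant_on_def by blast
  moreover have "path \<omega> constant_on {..<t0}"
    unfolding constant_on_def using path_collapsed[OF initial] by blast
  moreover have "path \<omega> t \<in> {0..1}" for t
    using path_bounds[of \<omega> t] a_nonneg[of t] b_le_1[of t] by auto
  then have "range (path \<omega>) \<subseteq> {0..1}"
    by blast
  ultimately show ?thesis
    using cadlag_path unfolding path_space_def by blast
qed

definition law :: "(real \<Rightarrow> real) measure" where
  "law = distr samples (path_algebra T t0) path"

lemma path_measurable_path_algebra [measurable]: "path \<in> measurable samples (path_algebra T t0)"
  unfolding path_algebra_def coord_algebra_def
proof (rule measurable_measure_of)
  fix y assume "y \<in> {(\<lambda>w. w s) -` A \<inter> path_space T t0 | s A. s \<in> UNIV \<and> A \<in> sets borel}"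
  then obtain s and A :: "real set" where y: "y = (\<lambda>w. w s) -` A \<inter> path_space T t0" and A: "A \<in> sets borel"
    by auto
  have "path -` y \<inter> space samples = (\<lambda>\<omega>. path \<omega> s) -` A \<inter> space samples"
    unfolding y using path_in_path_space by auto
  then show "path -` y \<inter> space samples \<in> sets samples"
    using measurable_sets[OF path_measurable A] by simp
qed (use path_in_path_space in auto)

lemma prob_space_law: "prob_space law"
  unfolding law_def by (rule prob_space.prob_space_distr[OF prob_space_samples]) measurable

lemma sets_law: "sets law = sets (path_algebra T t0)"
  by (simp add: law_def)

lemma coordinate_measurable_path_algebra: "(\<lambda>w. w t) \<in> borel_measurable (path_algebra T t0)"
  unfolding path_algebra_def by (rule measurable_coordinate) simp

lemma AE_law_iff:
  assumes "Measurable.pred borel Q"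
  shows "(AE w in law. Q (w t)) \<longleftrightarrow> (AE \<omega> in samples. Q (path \<omega> t))"
  unfolding law_def
proof (rule AE_distr_iff)
  show "{w \<in> space (path_algebra T t0). Q (w t)} \<in> sets (path_algebra T t0)"
    using measurable_compose[OF coordinate_measurable_path_algebra assms] by (simp add: pred_def)
qed measurable

lemma AE_law_two_point: "AE w in law. w t \<in> {a t, b t}"
proof -
  have "AE \<omega> in samples. path \<omega> t \<in> {a t, b t}"
    using AE_rich by eventually_elim (simp add: path_def)
  then show ?thesis
    using AE_law_iff[where Q = "\<lambda>x. x \<in> {a t, b t}" and t = t] by simp
qed

text \<open>On rich streams the path at time r is \<open>b r\<close> minus \<open>b r - a r\<close>
  times the indicator of \<open>low r\<close>. Both integrals thus become linear in two
  probabilities, and their equality is \<open>measure_low_Int\<close>.\<close>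

lemma integral_law:
  assumes st: "s \<le> t" and B: "B \<in> sets (path_filtration T t0 s)"
  shows "(\<integral>w. indicator B w * w t \<partial>law) = (\<integral>w. indicator B w * w s \<partial>law)"
proof -
  interpret S: prob_space samples by (rule prob_space_samples)
  let ?B = "{\<omega>. path \<omega> \<in> B}"
  have B'[measurable]: "B \<in> sets (path_algebra T t0)"
    using B sets_coord_algebra_mono[of "{..s}" UNIV T t0]
    by (auto simp: path_filtration_def path_algebra_def)
  have PB[measurable]: "?B \<in> sets samples"
    using measurable_sets[OF path_measurable_path_algebra B'] by (simp add: vimage_def)
  have L[measurable]: "{\<omega>. low r \<omega>} \<in> sets samples" for r
    using low_measurable[of r] by (simp add: pred_def)
  have inv: "x ## \<omega> \<in> ?B \<longleftrightarrow> \<omega> \<in> ?B" if "x \<notin> {a s..b s}" for x \<omega>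
    using coord_algebra_determined[OF B[unfolded path_filtration_def] path_in_path_space path_in_path_space,
        of "x ## \<omega>" \<omega>] path_Stream[OF _ that] by auto
  have *: "(\<integral>w. indicator B w * w r \<partial>law) =
      b r * S.prob ?B - (b r - a r) * S.prob ({\<omega>. low r \<omega>} \<inter> ?B)" for r
  proof -
    note [measurable] = coordinate_measurable_path_algebra
    have "(\<integral>w. indicator B w * w r \<partial>law) = (\<integral>\<omega>. indicator B (path \<omega>) * path \<omega> r \<partial>samples)"
      unfolding law_def by (rule integral_distr) measurable
    also have "\<dots> = (\<integral>\<omega>. b r * indicator ?B \<omega> - (b r - a r) * indicator ({\<omega>. low r \<omega>} \<inter> ?B) \<omega> \<partial>samples)"
    proof (rule integral_cong_AE)
      show "AE \<omega> in samples. indicator B (path \<omega>) * path \<omega> r =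
          b r * indicator ?B \<omega> - (b r - a r) * indicator ({\<omega>. low r \<omega>} \<inter> ?B) \<omega>"
        using AE_rich by eventually_elim (auto simp: path_def split: split_indicator)
    qed measurable
    also have "\<dots> = b r * S.prob ?B - (b r - a r) * S.prob ({\<omega>. low r \<omega>} \<inter> ?B)"
      by (subst Bochner_Integration.integral_diff) (auto simp: S.emeasure_eq_measure)
    finally show ?thesis .
  qed
  show ?thesis
    unfolding * using measure_low_Int[OF st PB inv] by (simp add: algebra_simps)
qed

lemma space_law: "space law = path_space T t0"
  by (simp add: law_def path_algebra_def)

lemma law_martingale_measure: "law \<in> martingale_measures T t0 p0"
proof -
  interpret prob_space law by (rule prob_space_law)
  have meas: "(\<lambda>w. w t) \<in> borel_measurable (path_filtration T t0 t)" for t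
    unfolding path_filtration_def by (rule measurable_coordinate) simp
  have "is_martingale law (path_filtration T t0) (\<lambda>t w. w t)"
  proof (rule is_martingaleI)
    show "integrable law (\<lambda>w. w t)" for t
    proof (rule integrable_const_bound[of _ 1])
      show "(\<lambda>w. w t) \<in> borel_measurable law"
        using measurable_from_subalg[OF subalgebra_path_filtration[OF sets_law] meas] .
      show "AE w in law. norm (w t) \<le> 1"
        using AE_space by eventually_elim (auto simp: space_law path_space_def image_subset_iff)
    qed
  next
    fix s t :: real and B assume "s \<le> t" "B \<in> sets (path_filtration T t0 s)"
    then show "(\<integral>w. indicator B w * w t \<partial>law) = (\<integral>w. indicator B w * w s \<partial>law)"
      by (rule integral_law)
  qed (rule prob_space_law subalgebra_path_filtration[OF sets_law] meas)+
  \<comment> \<open>Paths are constant before \<open>t0\<close> and from \<open>T\<close> on, so a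
    single time on each side handles uncountably many.\<close>
  moreover have "AE w in law. (\<forall>t<t0. w t = p0) \<and> (\<forall>t\<ge>T. w t \<in> {0, 1})"
    using AE_space AE_law_two_point[of "t0 - 1"] AE_law_two_point[of T]
  proof eventually_elim
    case (elim w)
    then have c: "w constant_on {..<t0}" "w constant_on {T..}"
      by (auto simp: space_law path_space_def)
    have "w t = w (t0 - 1)" if "t < t0" for t
      using c(1) that by (auto simp: constant_on_def)
    moreover have "w t = w T" if "T \<le> t" for t
      using c(2) that by (auto simp: constant_on_def)
    moreover have "w (t0 - 1) = p0" "w T \<in> {0, 1}"
      using elim terminal[of T] ab_initial[of "t0 - 1"] by auto
    ultimately show ?case
      by metis
  qed
  ultimately show ?thesis
    unfolding martingale_measures_def using prob_space_law sets_law by blast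
qed

end

section \<open>Martingale measures on two-point sets\<close>

text \<open>Membership in the two-point set means that the product of the two differences vanishes,
  a condition preserved by right limits even if it holds only frequently.\<close>

lemma right_limit_two_point:
  fixes w a b :: "real \<Rightarrow> real"
  assumes "(w \<longlongrightarrow> w t) (at_right t)" "(a \<longlongrightarrow> a t) (at_right t)" "(b \<longlongrightarrow> b t) (at_right t)"
    and "\<exists>\<^sub>F r in at_right t. w r \<in> {a r, b r}"
  shows "w t \<in> {a t, b t}"
proof (rule ccontr)
  assume "w t \<notin> {a t, b t}"
  then have "(w t - a t) * (w t - b t) \<noteq> 0" by auto
  moreover have "((\<lambda>r. (w r - a r) * (w r - b r)) \<longlongrightarrow> (w t - a t) * (w t - b t)) (at_right t)"
    by (intro tendsto_intros assms)
  ultimately have "\<forall>\<^sub>F r in at_right t. (w r - a r) * (w r - b r) \<noteq> 0"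
    using tendsto_imp_eventually_ne by blast
  then have "\<forall>\<^sub>F r in at_right t. w r \<notin> {a r, b r}"
    by eventually_elim auto
  with assms(4) show False
    by (simp add: frequently_def)
qed

text \<open>Discrete integration by parts. For martingales the first two sums have mean zero, and
  the third is the discrete covariation.\<close>

lemma product_diff_telescope:
  fixes x y :: "nat \<Rightarrow> real"
  shows "x n * y n - x 0 * y 0 =
    (\<Sum>i<n. x i * (y (Suc i) - y i)) + (\<Sum>i<n. y i * (x (Suc i) - x i)) +
    (\<Sum>i<n. (x (Suc i) - x i) * (y (Suc i) - y i))"
  by (induction n) (auto simp: algebra_simps)

section \<open>Dyadic partitions and variation along them\<close>

definition dyadic :: "real \<Rightarrow> real \<Rightarrow> nat \<Rightarrow> nat \<Rightarrow> real" where
  "dyadic s t n i = s + (t - s) * real i / 2 ^ n"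

lemma dyadic_0 [simp]: "dyadic s t n 0 = s"
  and dyadic_end [simp]: "dyadic s t n (2 ^ n) = t"
  and dyadic_Suc_double: "dyadic s t (Suc n) (2 * i) = dyadic s t n i"
  and dyadic_step: "dyadic s t n (Suc i) - dyadic s t n i = (t - s) / 2 ^ n"
  by (simp_all add: dyadic_def field_simps)

lemma dyadic_mono: "s \<le> t \<Longrightarrow> i \<le> j \<Longrightarrow> dyadic s t n i \<le> dyadic s t n j"
  unfolding dyadic_def by (intro add_left_mono divide_right_mono mult_left_mono) auto

lemma dyadic_ge: "s \<le> t \<Longrightarrow> s \<le> dyadic s t n i"
  using dyadic_mono[of s t 0 i n] by simp

lemma dyadic_le: "s \<le> t \<Longrightarrow> i \<le> 2 ^ n \<Longrightarrow> dyadic s t n i \<le> t"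
  using dyadic_mono[of s t i "2 ^ n" n] by simp

definition dyadic_variation :: "real \<Rightarrow> real \<Rightarrow> (real \<Rightarrow> real) \<Rightarrow> nat \<Rightarrow> real" where
  "dyadic_variation s t w n = (\<Sum>i<2^n. \<bar>w (dyadic s t n (Suc i)) - w (dyadic s t n i)\<bar>)"

lemma sum_lessThan_double:
  fixes f :: "nat \<Rightarrow> real"
  shows "sum f {..<2 * n} = (\<Sum>i<n. f (2 * i) + f (Suc (2 * i)))"
  by (induction n) auto

text \<open>Refinement halves every interval, so this is the triangle inequality. Monotonicity in n
  is what later allows monotone convergence for the supremum.\<close>

lemma incseq_dyadic_variation: "incseq (dyadic_variation s t w)"
proof (rule incseq_SucI)
  fix n
  let ?w = "\<lambda>n i. w (dyadic s t n i)"
  have "dyadic_variation s t w n = (\<Sum>i<2^n. \<bar>?w (Suc n) (2 * Suc i) - ?w (Suc n) (2 * i)\<bar>)"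
    unfolding dyadic_variation_def dyadic_Suc_double ..
  also have "\<dots> \<le> (\<Sum>i<2^n. \<bar>?w (Suc n) (Suc (2 * i)) - ?w (Suc n) (2 * i)\<bar> +
      \<bar>?w (Suc n) (Suc (Suc (2 * i))) - ?w (Suc n) (Suc (2 * i))\<bar>)"
    by (intro sum_mono) auto
  also have "\<dots> = dyadic_variation s t w (Suc n)"
    unfolding dyadic_variation_def power_Suc sum_lessThan_double ..
  finally show "dyadic_variation s t w n \<le> dyadic_variation s t w (Suc n)" .
qed

locale path_martingale =
  fixes T t0 p0 :: real and P :: "(real \<Rightarrow> real) measure"
  assumes P: "P \<in> martingale_measures T t0 p0"
begin

lemma prob_P: "prob_space P"
  and sets_P: "sets P = sets (path_algebra T t0)"
  and martingale_P: "is_martingale P (path_filtration T t0) (\<lambda>t w. w t)"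
  using P by (auto simp: martingale_measures_def)

sublocale prob_space P by (rule prob_P)

lemma space_P: "space P = path_space T t0"
  using sets_eq_imp_space_eq[OF sets_P] by (simp add: path_algebra_def)

lemma subalg: "subalgebra P (path_filtration T t0 t)"
  by (rule subalgebra_path_filtration[OF sets_P])

lemma coord_adapted: "s \<le> t \<Longrightarrow> (\<lambda>w. w s) \<in> borel_measurable (path_filtration T t0 t)"
  unfolding path_filtration_def by (rule measurable_coordinate) simp

lemma adapted_measurable: "f \<in> borel_measurable (path_filtration T t0 t) \<Longrightarrow> f \<in> borel_measurable P"
  by (rule measurable_from_subalg[OF subalg])

lemma coord_measurable [measurable]: "(\<lambda>w. w t) \<in> borel_measurable P"
  by (rule adapted_measurable[OF coord_adapted[OF order_refl]])

lemma AE_path_space: "AE w in P. w \<in> path_space T t0"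
  unfolding space_P[symmetric] by (rule AE_space)

lemma coord_bounds: "w \<in> path_space T t0 \<Longrightarrow> 0 \<le> w t" "w \<in> path_space T t0 \<Longrightarrow> w t \<le> 1"
  by (auto simp: path_space_def image_subset_iff)

lemma integral_mult_coord:
  assumes "s \<le> t" and f: "f \<in> borel_measurable (path_filtration T t0 s)" "integrable P f"
  shows "integrable P (\<lambda>w. f w * w t)" "(\<integral>w. f w * w t \<partial>P) = (\<integral>w. f w * w s \<partial>P)"
proof -
  have [measurable]: "f \<in> borel_measurable P" using f(2) by auto
  show *: "integrable P (\<lambda>w. f w * w t)"
  proof (rule Bochner_Integration.integrable_bound[OF f(2)])
    show "AE w in P. norm (f w * w t) \<le> norm (f w)"
      using AE_path_space
    proof eventually_elim
      case (elim w)
      then show ?case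
        using coord_bounds[of w t] by (simp add: abs_mult mult_left_le)
    qed
  qed measurable
  show "(\<integral>w. f w * w t \<partial>P) = (\<integral>w. f w * w s \<partial>P)"
    by (rule is_martingale_integral(2)[OF prob_P subalg martingale_P assms(1) f(1) *])
qed

lemma integral_coord: "(\<integral>w. w t \<partial>P) = p0"
proof -
  \<comment> \<open>A time not after \<open>t\<close> and strictly before \<open>t0\<close>, where
    the path is still at \<open>p0\<close>.\<close>
  let ?s = "min t (t0 - 1)"
  have "(\<integral>w. 1 * w t \<partial>P) = (\<integral>w. 1 * w ?s \<partial>P)"
    by (rule integral_mult_coord(2)) auto
  also have "\<dots> = (\<integral>w. p0 \<partial>P)"
  proof (rule integral_cong_AE)
    have "AE w in P. \<forall>t<t0. w t = p0"
      using P by (auto simp: martingale_measures_def)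
    then show "AE w in P. 1 * w ?s = p0"
      by eventually_elim simp
  qed measurable
  finally show ?thesis by (simp add: prob_space)
qed

end

locale two_point_martingale = terminal_corridor a b p0 T t0 + path_martingale T t0 p0 P
  for a b p0 T t0 P +
  assumes two_point: "AE w in P. w t \<in> {a t, b t}"
begin

text \<open>The exceptional null set in \<open>two_point\<close> depends on the time. Rational times
  share one null set, and right continuity of path and boundaries carries the property to all
  times.\<close>

lemma AE_two_point: "AE w in P. \<forall>t. w t \<in> {a t, b t}"
proof -
  have "AE w in P. \<forall>q::rat. w (of_rat q) \<in> {a (of_rat q), b (of_rat q)}"
    unfolding AE_all_countable using two_point by blast
  with AE_path_space show ?thesis
  proof eventually_elim
    case (elim w)
    show ?case
    proof
      fix t
      have "\<exists>\<^sub>F r in at_right t. w r \<in> {a r, b r}"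
        unfolding frequently_def
      proof
        assume "\<forall>\<^sub>F r in at_right t. w r \<notin> {a r, b r}"
        then obtain u where u: "t < u" "\<And>r. t < r \<Longrightarrow> r < u \<Longrightarrow> w r \<notin> {a r, b r}"
          unfolding eventually_at_right_field by blast
        obtain q where "t < of_rat q" "of_rat q < u"
          using of_rat_dense[OF u(1)] by blast
        with u(2) elim show False by blast
      qed
      then show "w t \<in> {a t, b t}"
        using elim a_right b_right
        by (intro right_limit_two_point) (auto simp: path_space_def cadlag_def)
    qed
  qed
qed

text \<open>Tested on the event \<open>w s = a s\<close>, the martingale property says that the
  conditional law on \<open>{a t, b t}\<close> has mean \<open>a s\<close>; the quotient is the
  weight of \<open>a t\<close> in this barycentre.\<close>

lemma cond_prob_low:
  assumes st: "s \<le> t" and pos: "0 < \<P>(w in P. w s = a s)" and ab: "a t < b t"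
  shows "\<P>(w in P. w t = a t \<bar> w s = a s) = (b t - a s) / (b t - a t)"
proof -
  let ?S = "{w \<in> space P. w s = a s}" and ?R = "{w \<in> space P. w t = a t \<and> w s = a s}"
  have [measurable]: "?S \<in> sets P" "?R \<in> sets P" by measurable
  have S': "?S \<in> sets (path_filtration T t0 s)"
  proof -
    have "{w \<in> space (path_filtration T t0 s). w s = a s} \<in> sets (path_filtration T t0 s)"
      using coord_adapted[of s s] by measurable
    then show ?thesis by (simp add: path_filtration_def space_P)
  qed
  have "(\<integral>w. indicator ?S w * w t \<partial>P) = (\<integral>w. indicator ?S w * w s \<partial>P)"
    using S' st by (intro integral_mult_coord(2)) (auto simp: emeasure_eq_measure)
  also have "\<dots> = (\<integral>w. a s * indicator ?S w \<partial>P)"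
    by (intro Bochner_Integration.integral_cong) (auto split: split_indicator)
  also have "\<dots> = a s * prob ?S" by simp
  also have "(\<integral>w. indicator ?S w * w t \<partial>P) = (\<integral>w. b t * indicator ?S w - (b t - a t) * indicator ?R w \<partial>P)"
  proof (rule integral_cong_AE)
    show "AE w in P. indicator ?S w * w t = b t * indicator ?S w - (b t - a t) * indicator ?R w"
      using two_point[of t] AE_space by eventually_elim (auto split: split_indicator)
  qed measurable
  also have "\<dots> = b t * prob ?S - (b t - a t) * prob ?R"
    by (subst Bochner_Integration.integral_diff) (auto simp: emeasure_eq_measure)
  finally have "(b t - a t) * prob ?R = (b t - a s) * prob ?S"
    by (simp add: algebra_simps)
  then show ?thesis
    using pos ab by (simp add: cond_prob_def field_simps)
qed

text \<open>The increment times a sign known at time \<open>s\<close> has mean zero. The sign is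
  chosen to count crossings to the other boundary positively; a path that follows its own boundary
  then gets the wrong sign, and correcting this costs at most twice the growth of that
  boundary.\<close>

lemma expected_abs_increment:
  assumes st: "s \<le> t"
  shows "(\<integral>w. \<bar>w t - w s\<bar> \<partial>P) \<le> 2 * ((b t - b s) + (a s - a t))"
proof -
  let ?c = "2 * ((b t - b s) + (a s - a t))"
  let ?f = "\<lambda>w::real\<Rightarrow>real. if w s = b s then -1 else 1 :: real"
  have f: "?f \<in> borel_measurable (path_filtration T t0 s)"
    using coord_adapted[of s s] by measurable
  have fi: "integrable P ?f"
    by (rule integrable_const_bound[of _ 1]) auto
  note i = integral_mult_coord(1)[OF st f fi] integral_mult_coord(1)[OF order_refl f fi]
  have d: "integrable P (\<lambda>w. w t - w s)"
  proof (rule integrable_const_bound[of _ 1])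
    show "AE w in P. norm (w t - w s) \<le> 1"
      using AE_path_space
    proof eventually_elim
      case (elim w)
      then show ?case using coord_bounds[of w t] coord_bounds[of w s] by auto
    qed
  qed measurable
  have "(\<integral>w. \<bar>w t - w s\<bar> \<partial>P) \<le> (\<integral>w. ?c + (?f w * w t - ?f w * w s) \<partial>P)"
  proof (rule integral_mono_AE)
    show "AE w in P. \<bar>w t - w s\<bar> \<le> ?c + (?f w * w t - ?f w * w s)"
      using two_point[of t] two_point[of s]
    proof eventually_elim
      case (elim w)
      then show ?case
        using a_antimono[OF st] b_mono[OF st] a_le_b[of s] a_le_b[of t] by auto
    qed
    show "integrable P (\<lambda>w. \<bar>w t - w s\<bar>)" using d by simp
    show "integrable P (\<lambda>w. ?c + (?f w * w t - ?f w * w s))"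
      using i by (intro Bochner_Integration.integrable_add Bochner_Integration.integrable_diff) auto
  qed
  also have "\<dots> = ?c"
    using i integral_mult_coord(2)[OF st f fi]
    by (subst Bochner_Integration.integral_add) (auto simp: prob_space)
  finally show ?thesis .
qed

lemma expected_dyadic_variation:
  assumes st: "s \<le> t"
  shows "integrable P (\<lambda>w. dyadic_variation s t w n)" "(\<integral>w. dyadic_variation s t w n \<partial>P) \<le> 2"
proof -
  let ?d = "dyadic s t n"
  have i: "integrable P (\<lambda>w. \<bar>w (?d (Suc i)) - w (?d i)\<bar>)" for i
  proof (rule integrable_const_bound[of _ 1])
    show "AE w in P. norm \<bar>w (?d (Suc i)) - w (?d i)\<bar> \<le> 1"
      using AE_path_space
    proof eventually_elim
      case (elim w)
      then show ?case using coord_bounds[of w "?d (Suc i)"] coord_bounds[of w "?d i"] by auto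
    qed
  qed measurable
  show "integrable P (\<lambda>w. dyadic_variation s t w n)"
    unfolding dyadic_variation_def using i by simp
  have "(\<integral>w. dyadic_variation s t w n \<partial>P) = (\<Sum>i<2^n. \<integral>w. \<bar>w (?d (Suc i)) - w (?d i)\<bar> \<partial>P)"
    unfolding dyadic_variation_def using i by simp
  also have "\<dots> \<le> (\<Sum>i<2^n. 2 * ((b (?d (Suc i)) - b (?d i)) + (a (?d i) - a (?d (Suc i)))))"
    using dyadic_mono[OF st] by (intro sum_mono expected_abs_increment) auto
  also have "\<dots> = 2 * ((\<Sum>i<2^n. b (?d (Suc i)) - b (?d i)) - (\<Sum>i<2^n. a (?d (Suc i)) - a (?d i)))"
    unfolding sum_distrib_left[symmetric] sum_subtractf[symmetric] by (simp add: algebra_simps)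
  also have "\<dots> = 2 * ((b t - b s) - (a t - a s))"
    using sum_lessThan_telescope[of "\<lambda>i. b (?d i)" "2 ^ n"] sum_lessThan_telescope[of "\<lambda>i. a (?d i)" "2 ^ n"]
    by simp
  \<comment> \<open>The width \<open>b - a\<close> stays between 0 and 1, so it grows by at most
    1.\<close>
  also have "\<dots> \<le> 2"
    using a_nonneg[of t] b_le_1[of t] a_le_b[of s] by simp
  finally show "(\<integral>w. dyadic_variation s t w n \<partial>P) \<le> 2" .
qed

text \<open>A dominating function common to all partitions: the pathwise supremum, whose expectation
  is at most 2 by monotone convergence.\<close>

lemma integrable_dyadic_variation_bound:
  assumes st: "s \<le> t"
  obtains V where "integrable P V" "AE w in P. \<forall>n. dyadic_variation s t w n \<le> V w"
proof -
  let ?v = "\<lambda>n w. dyadic_variation s t w n"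
  define V where "V w = (SUP n. ennreal (?v n w))" for w
  have v[measurable]: "?v n \<in> borel_measurable P" for n
    using expected_dyadic_variation(1)[OF st] by auto
  have nonneg: "0 \<le> ?v n w" for n w
    unfolding dyadic_variation_def by (intro sum_nonneg) auto
  have V[measurable]: "V \<in> borel_measurable P"
    unfolding V_def[abs_def] by measurable
  have "(\<integral>\<^sup>+w. V w \<partial>P) = (SUP n. \<integral>\<^sup>+w. ennreal (?v n w) \<partial>P)"
    unfolding V_def
    by (rule nn_integral_monotone_convergence_SUP)
      (use incseq_dyadic_variation in \<open>auto simp: incseq_def le_fun_def intro!: ennreal_leI\<close>)
  also have "\<dots> \<le> 2"
  proof (rule SUP_least)
    fix n
    have "(\<integral>\<^sup>+w. ennreal (?v n w) \<partial>P) = ennreal (\<integral>w. ?v n w \<partial>P)"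
      by (rule nn_integral_eq_integral) (use expected_dyadic_variation(1)[OF st] nonneg in auto)
    also have "\<dots> \<le> ennreal 2"
      using expected_dyadic_variation(2)[OF st] by (rule ennreal_leI)
    finally show "(\<integral>\<^sup>+w. ennreal (?v n w) \<partial>P) \<le> 2" by simp
  qed
  finally have le: "(\<integral>\<^sup>+w. V w \<partial>P) \<le> 2" .
  then have "(\<integral>\<^sup>+w. V w \<partial>P) \<noteq> \<infinity>"
    by (metis ennreal_numeral ennreal_neq_top infinity_ennreal_def neq_top_trans)
  then have fin: "AE w in P. V w \<noteq> \<infinity>"
    by (rule nn_integral_PInf_AE[OF V])
  have "integrable P (\<lambda>w. enn2real (V w))"
  proof (rule integrableI_nonneg)
    have "(\<integral>\<^sup>+w. ennreal (enn2real (V w)) \<partial>P) = (\<integral>\<^sup>+w. V w \<partial>P)"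
      by (rule nn_integral_cong_AE) (use fin in \<open>auto simp: less_top\<close>)
    also have "\<dots> < \<infinity>"
      using le by (rule le_less_trans) simp
    finally show "(\<integral>\<^sup>+w. ennreal (enn2real (V w)) \<partial>P) < \<infinity>" .
  qed auto
  moreover have "AE w in P. \<forall>n. ?v n w \<le> enn2real (V w)"
    using fin
  proof eventually_elim
    case (elim w)
    show ?case
    proof
      fix n
      have "ennreal (?v n w) \<le> V w" unfolding V_def by (rule SUP_upper) simp
      then show "?v n w \<le> enn2real (V w)"
        using elim nonneg[of w n] enn2real_mono[of "ennreal (?v n w)" "V w"] by (simp add: less_top)
    qed
  qed
  ultimately show ?thesis by (rule that)
qed

section \<open>Pure discontinuity\<close>

context
  fixes N :: "real \<Rightarrow> (real \<Rightarrow> real) \<Rightarrow> real" and s t :: real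
  assumes N: "continuous_L2_martingale P (path_filtration T t0) t0 N" and st: "s \<le> t"
begin

abbreviation (input) coord_step :: "nat \<Rightarrow> nat \<Rightarrow> (real \<Rightarrow> real) \<Rightarrow> real" where
  "coord_step n i w \<equiv> w (dyadic s t n (Suc i)) - w (dyadic s t n i)"

abbreviation (input) N_step :: "nat \<Rightarrow> nat \<Rightarrow> (real \<Rightarrow> real) \<Rightarrow> real" where
  "N_step n i w \<equiv> N (dyadic s t n (Suc i)) w - N (dyadic s t n i) w"

lemma N_martingale: "is_martingale P (path_filtration T t0) N"
  and N_square_integrable: "integrable P (\<lambda>w. (N r w)\<^sup>2)"
  using N by (auto simp: continuous_L2_martingale_def)

lemma N_adapted: "N r \<in> borel_measurable (path_filtration T t0 r)"
  and N_integrable: "integrable P (N r)"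
  using N_martingale by (auto simp: is_martingale_def)

lemma N_measurable [measurable]: "N r \<in> borel_measurable P"
  using N_integrable by auto

lemma N_mult_integrable: "integrable P (\<lambda>w. N q w * N r w)"
proof (rule Bochner_Integration.integrable_bound)
  show "integrable P (\<lambda>w. (N q w)\<^sup>2 + (N r w)\<^sup>2)"
    by (intro Bochner_Integration.integrable_add N_square_integrable)
  show "AE w in P. norm (N q w * N r w) \<le> norm ((N q w)\<^sup>2 + (N r w)\<^sup>2)"
  proof (intro AE_I2)
    fix w
    have "0 \<le> (\<bar>N q w\<bar> - \<bar>N r w\<bar>)\<^sup>2 + (N q w)\<^sup>2 + (N r w)\<^sup>2" by simp
    then show "norm (N q w * N r w) \<le> norm ((N q w)\<^sup>2 + (N r w)\<^sup>2)"
      by (simp add: power2_diff abs_mult)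
  qed
qed measurable

lemma N_step_square:
  "integrable P (\<lambda>w. (N_step n i w)\<^sup>2)"
  "(\<integral>w. (N_step n i w)\<^sup>2 \<partial>P) =
    (\<integral>w. (N (dyadic s t n (Suc i)) w)\<^sup>2 \<partial>P) - (\<integral>w. (N (dyadic s t n i) w)\<^sup>2 \<partial>P)"
proof -
  let ?q = "dyadic s t n i" and ?r = "dyadic s t n (Suc i)"
  have qr: "?q \<le> ?r" using dyadic_mono[OF st] by auto
  have eq: "(N_step n i w)\<^sup>2 = ((N ?r w)\<^sup>2 - 2 * (N ?q w * N ?r w)) + N ?q w * N ?q w" for w
    by (simp add: power2_eq_square algebra_simps)
  show "integrable P (\<lambda>w. (N_step n i w)\<^sup>2)"
    unfolding eq using N_square_integrable N_mult_integrable by simp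
  have "(\<integral>w. N ?q w * N ?r w \<partial>P) = (\<integral>w. N ?q w * N ?q w \<partial>P)"
    by (rule is_martingale_integral(2)[OF prob_P subalg N_martingale qr N_adapted N_mult_integrable])
  then show "(\<integral>w. (N_step n i w)\<^sup>2 \<partial>P) = (\<integral>w. (N ?r w)\<^sup>2 \<partial>P) - (\<integral>w. (N ?q w)\<^sup>2 \<partial>P)"
    unfolding eq using N_square_integrable N_mult_integrable
    by (simp add: power2_eq_square)
qed

text \<open>Martingale increments are orthogonal, so the expected squares telescope and the result
  is the same for every partition.\<close>

lemma quadratic_variation:
  "integrable P (\<lambda>w. \<Sum>i<2^n. (N_step n i w)\<^sup>2)"
  "(\<integral>w. (\<Sum>i<2^n. (N_step n i w)\<^sup>2) \<partial>P) = (\<integral>w. (N t w)\<^sup>2 \<partial>P) - (\<integral>w. (N s w)\<^sup>2 \<partial>P)"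
proof -
  show "integrable P (\<lambda>w. \<Sum>i<2^n. (N_step n i w)\<^sup>2)"
    using N_step_square(1) by (intro Bochner_Integration.integrable_sum)
  have "(\<integral>w. (\<Sum>i<2^n. (N_step n i w)\<^sup>2) \<partial>P) = (\<Sum>i<2^n. \<integral>w. (N_step n i w)\<^sup>2 \<partial>P)"
    using N_step_square(1) by (rule Bochner_Integration.integral_sum)
  also have "\<dots> = (\<Sum>i<2^n. (\<integral>w. (N (dyadic s t n (Suc i)) w)\<^sup>2 \<partial>P) - (\<integral>w. (N (dyadic s t n i) w)\<^sup>2 \<partial>P))"
    unfolding N_step_square(2) ..
  also have "\<dots> = (\<integral>w. (N t w)\<^sup>2 \<partial>P) - (\<integral>w. (N s w)\<^sup>2 \<partial>P)"
    using sum_lessThan_telescope[of "\<lambda>i. \<integral>w. (N (dyadic s t n i) w)\<^sup>2 \<partial>P" "2 ^ n"] by simp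
  finally show "(\<integral>w. (\<Sum>i<2^n. (N_step n i w)\<^sup>2) \<partial>P) = (\<integral>w. (N t w)\<^sup>2 \<partial>P) - (\<integral>w. (N s w)\<^sup>2 \<partial>P)" .
qed

lemma abs_coord_step_le_1: "w \<in> path_space T t0 \<Longrightarrow> \<bar>coord_step n i w\<bar> \<le> 1"
  using coord_bounds[of w "dyadic s t n (Suc i)"] coord_bounds[of w "dyadic s t n i"] by auto

lemma N_step_integrable: "integrable P (N_step n i)"
  using N_integrable by simp

lemma product_step_integrable: "integrable P (\<lambda>w. coord_step n i w * N_step n i w)"
proof (rule Bochner_Integration.integrable_bound[OF N_step_integrable])
  show "AE w in P. norm (coord_step n i w * N_step n i w) \<le> norm (N_step n i w)"
    using AE_path_space
  proof eventually_elim
    case (elim w)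
    show ?case
      using mult_right_mono[OF abs_coord_step_le_1[OF elim], of "\<bar>N_step n i w\<bar>"] by (simp add: abs_mult)
  qed
qed measurable

text \<open>After discrete integration by parts, each term with one factor frozen at the left end
  point has mean zero on \<open>B\<close>. Only the covariation sum survives, for every
  \<open>n\<close>.\<close>

lemma product_increment:
  assumes B: "B \<in> sets (path_filtration T t0 s)"
  shows "(\<integral>w. indicator B w * (w t * N t w) \<partial>P) - (\<integral>w. indicator B w * (w s * N s w) \<partial>P) =
    (\<integral>w. indicator B w * (\<Sum>i<2^n. coord_step n i w * N_step n i w) \<partial>P)"
proof -
  let ?d = "dyadic s t n"
  have B': "B \<in> sets (path_filtration T t0 r)" if "s \<le> r" for r
    using B sets_coord_algebra_mono[of "{..s}" "{..r}" T t0] that by (auto simp: path_filtration_def)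
  have BP[measurable]: "B \<in> sets P"
    using B subalg[of s] by (auto simp: subalgebra_def)
  have wN: "integrable P (\<lambda>w. indicator B w * (w q * N r w))" for q r
  proof (rule Bochner_Integration.integrable_bound[OF N_integrable[of r]])
    show "AE w in P. norm (indicator B w * (w q * N r w)) \<le> norm (N r w)"
      using AE_path_space
    proof eventually_elim
      case (elim w)
      have "\<bar>w q\<bar> * \<bar>N r w\<bar> \<le> 1 * \<bar>N r w\<bar>"
        using coord_bounds[OF elim, of q] by (intro mult_right_mono) auto
      then show ?case by (simp add: abs_mult split: split_indicator)
    qed
  qed measurable
  have 1: "(\<integral>w. indicator B w * (w (?d i) * N_step n i w) \<partial>P) = 0" for i
  proof -
    have "(\<integral>w. (indicator B w * w (?d i)) * N (?d (Suc i)) w \<partial>P) = (\<integral>w. (indicator B w * w (?d i)) * N (?d i) w \<partial>P)"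
    proof (rule is_martingale_integral(2)[OF prob_P subalg N_martingale])
      show "?d i \<le> ?d (Suc i)" using dyadic_mono[OF st] by auto
      show "(\<lambda>w. indicator B w * w (?d i)) \<in> borel_measurable (path_filtration T t0 (?d i))"
        by (intro borel_measurable_times borel_measurable_indicator B'[OF dyadic_ge[OF st]] coord_adapted order_refl)
      show "integrable P (\<lambda>w. indicator B w * w (?d i) * N (?d (Suc i)) w)"
        using wN by (simp add: mult.assoc)
    qed
    then show ?thesis
      using wN[of "?d i" "?d (Suc i)"] wN[of "?d i" "?d i"] by (simp add: right_diff_distrib mult.assoc)
  qed
  have 2: "(\<integral>w. indicator B w * (N (?d i) w * coord_step n i w) \<partial>P) = 0" for i
  proof -
    have f: "(\<lambda>w. indicator B w * N (?d i) w) \<in> borel_measurable (path_filtration T t0 (?d i))"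
      by (intro borel_measurable_times borel_measurable_indicator B'[OF dyadic_ge[OF st]] N_adapted)
    have fi: "integrable P (\<lambda>w. indicator B w * N (?d i) w)"
      using integrable_mult_indicator[OF BP N_integrable] by simp
    have le: "?d i \<le> ?d (Suc i)" using dyadic_mono[OF st] by auto
    show ?thesis
      using integral_mult_coord(2)[OF le f fi] wN[of "?d (Suc i)" "?d i"] wN[of "?d i" "?d i"]
      by (simp add: right_diff_distrib mult.assoc mult.commute[of "N _ _" "_ (dyadic _ _ _ _)"])
  qed
  have i1: "integrable P (\<lambda>w. indicator B w * (w (?d i) * N_step n i w))" for i
    using wN[of "?d i" "?d (Suc i)"] wN[of "?d i" "?d i"] by (simp add: right_diff_distrib)
  have i2: "integrable P (\<lambda>w. indicator B w * (N (?d i) w * coord_step n i w))" for i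
    using wN[of "?d (Suc i)" "?d i"] wN[of "?d i" "?d i"]
    by (simp add: right_diff_distrib mult.commute[of "N _ _" "_ (dyadic _ _ _ _)"])
  have i3: "integrable P (\<lambda>w. indicator B w * (coord_step n i w * N_step n i w))" for i
    using integrable_mult_indicator[OF BP product_step_integrable] by simp
  have "(\<integral>w. indicator B w * (w t * N t w) \<partial>P) - (\<integral>w. indicator B w * (w s * N s w) \<partial>P) =
      (\<integral>w. indicator B w * (w (?d (2^n)) * N (?d (2^n)) w - w (?d 0) * N (?d 0) w) \<partial>P)"
    using wN by (simp add: right_diff_distrib)
  also have "\<dots> = (\<integral>w. (\<Sum>i<2^n. indicator B w * (w (?d i) * N_step n i w)) +
      (\<Sum>i<2^n. indicator B w * (N (?d i) w * coord_step n i w)) +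
      (\<Sum>i<2^n. indicator B w * (coord_step n i w * N_step n i w)) \<partial>P)"
    using product_diff_telescope[of "\<lambda>i. _ (?d i)" "2 ^ n" "\<lambda>i. N (?d i) _"]
    by (intro Bochner_Integration.integral_cong refl) (simp only: sum_distrib_left distrib_left)
  also have "\<dots> = (\<integral>w. (\<Sum>i<2^n. indicator B w * (coord_step n i w * N_step n i w)) \<partial>P)"
  proof -
    have s: "integrable P (\<lambda>w. \<Sum>i<2^n. f i w)" "(\<integral>w. (\<Sum>i<2^n. f i w) \<partial>P) = (\<Sum>i<2^n. \<integral>w. f i w \<partial>P)"
      if "\<And>i. integrable P (f i)" for f :: "nat \<Rightarrow> (real \<Rightarrow> real) \<Rightarrow> real"
      using that by (simp_all add: Bochner_Integration.integral_sum)
    show ?thesis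
      using s(1)[OF i1] s(1)[OF i2] s(1)[OF i3] s(2)[OF i1] s(2)[OF i2]
      by (simp only: Bochner_Integration.integral_add Bochner_Integration.integrable_add 1 2
          sum.neutral_const add_0_left)
  qed
  finally show ?thesis
    by (simp add: sum_distrib_left)
qed

text \<open>The cross variation is at most \<open>d\<close> off the event where it exceeds \<open>d\<close>, and on that event at most
  a small multiple of the quadratic variation of \<open>N\<close> plus a large multiple of the total variation
  of the path, whose integral over these vanishing events tends to zero.\<close>

lemma cross_variation_small:
  assumes e: "0 < e"
  shows "\<exists>n. (\<integral>w. (\<Sum>i<2^n. \<bar>coord_step n i w * N_step n i w\<bar>) \<partial>P) \<le> e"
proof -
  obtain V where V: "integrable P V" "AE w in P. \<forall>n. dyadic_variation s t w n \<le> V w"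
    using integrable_dyadic_variation_bound[OF st] .
  let ?Y = "\<lambda>n w. \<Sum>i<2^n. \<bar>coord_step n i w * N_step n i w\<bar>"
  let ?Q = "\<lambda>n w. \<Sum>i<2^n. (N_step n i w)\<^sup>2"
  define C where "C = (\<integral>w. (N t w)\<^sup>2 \<partial>P) - (\<integral>w. (N s w)\<^sup>2 \<partial>P)"
  \<comment> \<open>Three shares of \<open>e / 3\<close>: the threshold \<open>d\<close>, the
    quadratic variation weighted by \<open>l\<close>, and the variation bound divided by
    \<open>l\<close>, made small by the choice of \<open>n\<close>. The \<open>+ 1\<close> in
    \<open>l\<close> keeps its denominator positive.\<close>
  define d where "d = e / 3"
  define l where "l = e / (3 * (\<bar>C\<bar> + 1))"
  have d: "0 < d" and l: "0 < l" and lC: "l * C \<le> e / 3"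
  proof -
    show "0 < d" "0 < l" using e by (auto simp: d_def l_def)
    have "l * C \<le> l * (\<bar>C\<bar> + 1)" using \<open>0 < l\<close> by (intro mult_left_mono) auto
    also have "\<dots> = e / 3" by (simp add: l_def field_simps add_nonneg_eq_0_iff)
    finally show "l * C \<le> e / 3" .
  qed
  have [measurable]: "V \<in> borel_measurable P" using V(1) by auto
  have Y_meas[measurable]: "?Y n \<in> borel_measurable P" for n
    by measurable
  have Y_le_V: "AE w in P. \<forall>n. ?Y n w \<le> l * ?Q n w + V w / l"
    using V(2) AE_path_space
  proof eventually_elim
    case (elim w)
    show ?case
    proof
      fix n
      \<comment> \<open>A weighted inequality of means, x y <= l y^2 + x^2 / l, followed by x^2 <=
        x, since path increments are at most 1 in absolute value.\<close>
      have step: "\<bar>coord_step n i w * N_step n i w\<bar> \<le> l * (N_step n i w)\<^sup>2 + \<bar>coord_step n i w\<bar> / l" for i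
      proof -
        let ?x = "\<bar>coord_step n i w\<bar>" and ?y = "\<bar>N_step n i w\<bar>"
        have "0 \<le> (l * ?y - ?x)\<^sup>2 + l\<^sup>2 * ?y\<^sup>2 + ?x\<^sup>2" by simp
        then have "l * (?x * ?y) \<le> l * (l * ?y\<^sup>2) + ?x\<^sup>2"
          by (simp add: power2_eq_square algebra_simps)
        also have "?x\<^sup>2 \<le> ?x"
          using mult_left_mono[OF abs_coord_step_le_1[OF elim(2), of n i], of ?x] by (simp add: power2_eq_square)
        finally have "?x * ?y \<le> (l * (l * ?y\<^sup>2) + ?x) / l"
          using l by (simp add: field_simps)
        then show ?thesis
          using l by (simp add: abs_mult add_divide_distrib)
      qed
      have "?Y n w \<le> (\<Sum>i<2^n. l * (N_step n i w)\<^sup>2 + \<bar>coord_step n i w\<bar> / l)"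
        by (intro sum_mono step)
      also have "\<dots> = l * ?Q n w + dyadic_variation s t w n / l"
        by (simp add: sum.distrib sum_distrib_left sum_divide_distrib dyadic_variation_def)
      also have "\<dots> \<le> l * ?Q n w + V w / l"
        using elim l by (intro add_left_mono divide_right_mono) auto
      finally show "?Y n w \<le> l * ?Q n w + V w / l" .
    qed
  qed
  \<comment> \<open>Pathwise, the steps of \<open>N\<close> become uniformly small by uniform
    continuity on \<open>{s..t}\<close>, while the variation of the coordinate path stays below
    \<open>V w\<close>.\<close>
  have Y_lim: "AE w in P. (\<lambda>n. ?Y n w) \<longlonglongrightarrow> 0"
    using V(2) N[unfolded continuous_L2_martingale_def, THEN conjunct2, THEN conjunct2]
  proof eventually_elim
    case (elim w)
    have "0 \<le> V w"
    proof -
      have "0 \<le> dyadic_variation s t w 0" by (simp add: dyadic_variation_def)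
      with elim(1) show ?thesis using order_trans by blast
    qed
    have "uniformly_continuous_on {s..t} (\<lambda>r. N r w)"
      using elim(2) by (intro compact_uniformly_continuous) (auto intro: continuous_on_subset)
    show ?case
    proof (rule LIMSEQ_I)
      fix r :: real assume r: "0 < r"
      define r' where "r' = r / (2 * (V w + 1))"
      have r': "0 < r'" using r \<open>0 \<le> V w\<close> by (simp add: r'_def)
      then obtain \<delta> where \<delta>: "0 < \<delta>" "\<And>x y. x \<in> {s..t} \<Longrightarrow> y \<in> {s..t} \<Longrightarrow> dist y x < \<delta> \<Longrightarrow> dist (N y w) (N x w) < r'"
        using \<open>uniformly_continuous_on {s..t} (\<lambda>r. N r w)\<close> unfolding uniformly_continuous_on_def by metis
      have "(\<lambda>n. (t - s) / 2 ^ n) \<longlonglongrightarrow> 0"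
        by (rule LIMSEQ_divide_realpow_zero) simp
      from LIMSEQ_D[OF this \<delta>(1)] obtain m where m: "\<And>n. m \<le> n \<Longrightarrow> \<bar>(t - s) / 2 ^ n\<bar> < \<delta>"
        by auto
      show "\<exists>m. \<forall>n\<ge>m. norm (?Y n w - 0) < r"
      proof (intro exI[of _ m] allI impI)
        fix n assume n: "m \<le> n"
        have "\<bar>coord_step n i w * N_step n i w\<bar> \<le> \<bar>coord_step n i w\<bar> * r'" if "i < 2 ^ n" for i
        proof -
          have "dist (N (dyadic s t n (Suc i)) w) (N (dyadic s t n i) w) < r'"
            using that m[OF n] dyadic_ge[OF st] dyadic_le[OF st]
            by (intro \<delta>(2)) (auto simp: dist_real_def dyadic_step)
          then show ?thesis
            unfolding abs_mult by (intro mult_left_mono) (auto simp: dist_real_def)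
        qed
        then have "?Y n w \<le> (\<Sum>i<2^n. \<bar>coord_step n i w\<bar> * r')"
          by (intro sum_mono) auto
        also have "\<dots> = dyadic_variation s t w n * r'"
          by (simp add: dyadic_variation_def sum_distrib_right)
        also have "\<dots> \<le> (V w + 1) * r'"
          using elim(1) r' by (intro mult_right_mono) (auto intro: order_trans)
        also have "\<dots> = r / 2"
          using \<open>0 \<le> V w\<close> by (simp add: r'_def field_simps)
        also have "\<dots> < r" using r by simp
        finally have "?Y n w < r" .
        moreover have "0 \<le> ?Y n w" by (intro sum_nonneg) auto
        ultimately show "norm (?Y n w - 0) < r" by simp
      qed
    qed
  qed
  let ?v = "\<lambda>n. \<integral>w. V w * indicator {w \<in> space P. d < ?Y n w} w \<partial>P"
  have [measurable]: "{w \<in> space P. d < ?Y n w} \<in> sets P" for n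
    by measurable
  have Vi: "integrable P (\<lambda>w. V w * indicator {w \<in> space P. d < ?Y n w} w)" for n
    using integrable_mult_indicator[OF _ V(1), of "{w \<in> space P. d < ?Y n w}"] by (simp add: mult.commute)
  have "?v \<longlonglongrightarrow> (\<integral>w. 0 \<partial>P)"
  proof (rule integral_dominated_convergence)
    show "integrable P (\<lambda>w. norm (V w))" using V(1) by simp
    show "AE w in P. (\<lambda>n. V w * indicator {w \<in> space P. d < ?Y n w} w) \<longlonglongrightarrow> 0"
      using Y_lim
    proof eventually_elim
      case (elim w)
      have "\<forall>\<^sub>F n in sequentially. ?Y n w < d"
        using order_tendstoD(2)[OF elim d] .
      then have "\<forall>\<^sub>F n in sequentially. V w * indicator {w \<in> space P. d < ?Y n w} w = 0"
        by eventually_elim auto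
      then show ?case by (rule tendsto_eventually)
    qed
    show "AE w in P. norm (V w * indicator {w \<in> space P. d < ?Y n w} w) \<le> norm (V w)" for n
      by (intro AE_I2) (auto split: split_indicator)
  qed measurable
  \<comment> \<open>The factor \<open>l\<close> anticipates the division by \<open>l\<close> in the
    final estimate.\<close>
  moreover have "0 < l * (e / 3)" using l e by simp
  ultimately have "\<forall>\<^sub>F n in sequentially. ?v n < l * (e / 3)"
    by (intro order_tendstoD(2)[of ?v 0]) simp_all
  then obtain n where n: "?v n < l * (e / 3)"
    unfolding eventually_sequentially by blast
  have Yi: "integrable P (?Y n)"
    using product_step_integrable by (intro Bochner_Integration.integrable_sum) simp
  have "(\<integral>w. ?Y n w \<partial>P) \<le> (\<integral>w. d + l * ?Q n w + (V w * indicator {w \<in> space P. d < ?Y n w} w) / l \<partial>P)"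
  proof (rule integral_mono_AE[OF Yi])
    show "integrable P (\<lambda>w. d + l * ?Q n w + (V w * indicator {w \<in> space P. d < ?Y n w} w) / l)"
      using quadratic_variation(1) Vi by simp
    show "AE w in P. ?Y n w \<le> d + l * ?Q n w + (V w * indicator {w \<in> space P. d < ?Y n w} w) / l"
      using Y_le_V AE_space
    proof eventually_elim
      case (elim w)
      have "0 \<le> l * ?Q n w" using l by (intro mult_nonneg_nonneg sum_nonneg) auto
      then show ?case
        using elim(1)[rule_format, of n] elim(2) d by (cases "d < ?Y n w") simp_all
    qed
  qed
  also have "\<dots> = d + l * C + ?v n / l"
    using quadratic_variation[of n] Vi[of n] by (simp add: prob_space C_def)
  also have "\<dots> \<le> e / 3 + e / 3 + e / 3"
    using lC n l by (intro add_mono) (auto simp: d_def field_simps)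
  finally show ?thesis by auto
qed

text \<open>The difference of the two sides does not depend on the partition, yet it is bounded by
  the expected cross variation, which is below any given positive number for some partition.\<close>

lemma integral_product:
  assumes B: "B \<in> sets (path_filtration T t0 s)"
  shows "(\<integral>w. indicator B w * (w t * N t w) \<partial>P) = (\<integral>w. indicator B w * (w s * N s w) \<partial>P)"
proof -
  let ?I = "(\<integral>w. indicator B w * (w t * N t w) \<partial>P) - (\<integral>w. indicator B w * (w s * N s w) \<partial>P)"
  have BP[measurable]: "B \<in> sets P"
    using B subalg[of s] by (auto simp: subalgebra_def)
  have "\<bar>?I\<bar> \<le> e" if e: "0 < e" for e
  proof -
    obtain n where n: "(\<integral>w. (\<Sum>i<2^n. \<bar>coord_step n i w * N_step n i w\<bar>) \<partial>P) \<le> e"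
      using cross_variation_small[OF e] by blast
    have "\<bar>?I\<bar> \<le> (\<integral>w. \<bar>indicator B w * (\<Sum>i<2^n. coord_step n i w * N_step n i w)\<bar> \<partial>P)"
      unfolding product_increment[OF B, of n] by (rule integral_abs_bound)
    also have "\<dots> \<le> (\<integral>w. (\<Sum>i<2^n. \<bar>coord_step n i w * N_step n i w\<bar>) \<partial>P)"
    proof (rule integral_mono)
      have "integrable P (\<lambda>w. \<Sum>i<2^n. coord_step n i w * N_step n i w)"
        using product_step_integrable by (intro Bochner_Integration.integrable_sum)
      from integrable_mult_indicator[OF BP this]
      show "integrable P (\<lambda>w. \<bar>indicator B w * (\<Sum>i<2^n. coord_step n i w * N_step n i w)\<bar>)"
        by simp
      show "integrable P (\<lambda>w. \<Sum>i<2^n. \<bar>coord_step n i w * N_step n i w\<bar>)"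
        using product_step_integrable by (intro Bochner_Integration.integrable_sum) simp
      show "\<bar>indicator B w * (\<Sum>i<2^n. coord_step n i w * N_step n i w)\<bar> \<le>
          (\<Sum>i<2^n. \<bar>coord_step n i w * N_step n i w\<bar>)" for w
        by (auto split: split_indicator intro!: sum_nonneg)
    qed
    finally show ?thesis using n by simp
  qed
  then have "\<bar>?I\<bar> \<le> 0" by (rule field_le_epsilon) simp
  then show ?thesis by simp
qed

end

lemma purely_discontinuous_coordinate:
  "purely_discontinuous P (path_filtration T t0) t0 (\<lambda>t w. w t)"
  unfolding purely_discontinuous_def continuous_martingale_part_def
proof (intro conjI allI impI)
  have "is_martingale P (path_filtration T t0) (\<lambda>t w. 0)"
    by (rule is_martingaleI) (auto intro: prob_P subalg)
  then show "continuous_L2_martingale P (path_filtration T t0) t0 (\<lambda>t w. 0)"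
    by (simp add: continuous_L2_martingale_def)
next
  fix N assume N: "continuous_L2_martingale P (path_filtration T t0) t0 N"
  show "is_martingale P (path_filtration T t0) (\<lambda>t w. (w t - 0) * N t w)"
  proof (rule is_martingaleI)
    fix t
    show "(\<lambda>w. (w t - 0) * N t w) \<in> borel_measurable (path_filtration T t0 t)"
      using coord_adapted[of t t] N_adapted[OF N order_refl, of t] by measurable
    show "integrable P (\<lambda>w. (w t - 0) * N t w)"
      using integral_mult_coord(1)[OF order_refl N_adapted[OF N order_refl] N_integrable[OF N order_refl]]
      by (simp add: mult.commute)
  next
    fix s t and B :: "(real \<Rightarrow> real) set" assume "s \<le> t" "B \<in> sets (path_filtration T t0 s)"
    then show "(\<integral>w. indicator B w * ((w t - 0) * N t w) \<partial>P) = (\<integral>w. indicator B w * ((w s - 0) * N s w) \<partial>P)"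
      using integral_product[OF N] by simp
  qed (rule prob_P subalg)+
qed

section \<open>Uniqueness\<close>

text \<open>Bounds are asked on the unit interval only, where the paths live: the affine functions
  multiplied in during the induction on times are unbounded on the line.\<close>

lemma coordinate_functions_product:
  fixes g :: "real \<Rightarrow> real \<Rightarrow> real"
  assumes J: "finite J" "\<And>r. r \<in> J \<Longrightarrow> r \<le> s"
    and g: "\<And>r. g r \<in> borel_measurable borel" "\<And>r. \<exists>C. \<forall>x\<in>{0..1}. \<bar>g r x\<bar> \<le> C"
  shows "(\<lambda>w. \<Prod>r\<in>J. g r (w r)) \<in> borel_measurable (path_filtration T t0 s)"
    and "integrable P (\<lambda>w. \<Prod>r\<in>J. g r (w r))"
proof -
  show *: "(\<lambda>w. \<Prod>r\<in>J. g r (w r)) \<in> borel_measurable (path_filtration T t0 s)"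
    using J(2) by (intro borel_measurable_prod measurable_compose[OF coord_adapted g(1)])
  obtain C where C: "\<And>r x. x \<in> {0..1} \<Longrightarrow> \<bar>g r x\<bar> \<le> C r"
    using g(2) by metis
  show "integrable P (\<lambda>w. \<Prod>r\<in>J. g r (w r))"
  proof (rule integrable_const_bound[of _ "\<Prod>r\<in>J. C r"])
    show "AE w in P. norm (\<Prod>r\<in>J. g r (w r)) \<le> (\<Prod>r\<in>J. C r)"
      using AE_path_space
    proof eventually_elim
      case (elim w)
      then show ?case
        using coord_bounds[OF elim] C by (auto simp: abs_prod intro!: prod_mono)
    qed
  qed (rule adapted_measurable[OF *])
qed

text \<open>On the two-point set every function is affine, so the martingale property removes the last time
  from the expectation of a product of functions of the coordinates.\<close>

definition affine_slope :: "(real \<Rightarrow> real) \<Rightarrow> real \<Rightarrow> real" where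
  "affine_slope g t = (g (b t) - g (a t)) / (b t - a t)"

definition affine_form :: "(real \<Rightarrow> real) \<Rightarrow> real \<Rightarrow> real \<Rightarrow> real" where
  "affine_form g t x = g (a t) - affine_slope g t * a t + affine_slope g t * x"

lemma affine_form_eq: "x \<in> {a t, b t} \<Longrightarrow> affine_form g t x = g x"
proof -
  \<comment> \<open>Centred at \<open>a t\<close>, the form is correct in a collapsed corridor too:
    the slope, then a division by zero, is multiplied by 0.\<close>
  have "affine_form g t x = g (a t) + affine_slope g t * (x - a t)"
    by (simp add: affine_form_def algebra_simps)
  then show "x \<in> {a t, b t} \<Longrightarrow> affine_form g t x = g x"
    by (cases "a t = b t") (auto simp: affine_slope_def)
qed

lemma integral_mult_two_point:
  assumes st: "s \<le> t" and f: "f \<in> borel_measurable (path_filtration T t0 s)" "integrable P f"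
    and g: "g \<in> borel_measurable borel"
  shows "(\<integral>w. f w * g (w t) \<partial>P) = (\<integral>w. f w * affine_form g t (w s) \<partial>P)"
proof -
  have [measurable]: "f \<in> borel_measurable P" "g \<in> borel_measurable borel"
    using f(2) g by auto
  have aff: "(\<integral>w. f w * affine_form g t (w r) \<partial>P) =
      (g (a t) - affine_slope g t * a t) * (\<integral>w. f w \<partial>P) + affine_slope g t * (\<integral>w. f w * w r \<partial>P)"
    if "integrable P (\<lambda>w. f w * w r)" for r
  proof -
    have eq: "f w * affine_form g t (w r) =
        (g (a t) - affine_slope g t * a t) * f w + affine_slope g t * (f w * w r)" for w
      by (simp add: affine_form_def algebra_simps)
    show ?thesis
      unfolding eq using that f(2) by simp
  qed
  have "(\<integral>w. f w * g (w t) \<partial>P) = (\<integral>w. f w * affine_form g t (w t) \<partial>P)"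
  proof (rule integral_cong_AE)
    show "AE w in P. f w * g (w t) = f w * affine_form g t (w t)"
      using two_point[of t] by eventually_elim (simp add: affine_form_eq)
  qed (simp_all add: affine_form_def)
  also have "\<dots> = (\<integral>w. f w * affine_form g t (w s) \<partial>P)"
    using aff integral_mult_coord(1)[OF st f] integral_mult_coord(1)[OF order_refl f]
      integral_mult_coord(2)[OF st f] by simp
  finally show ?thesis .
qed

text \<open>The factor at the latest time becomes an affine function of the state at the preceding
  time \<open>Max J\<close> and is absorbed there. The expression keeps its shape with one time
  less, ready for induction.\<close>

lemma integral_product_insert:
  fixes g :: "real \<Rightarrow> real \<Rightarrow> real"
  assumes J: "finite J" "J \<noteq> {}" "\<And>r. r \<in> J \<Longrightarrow> r < t"
    and g: "\<And>r. g r \<in> borel_measurable borel" "\<And>r. \<exists>C. \<forall>x\<in>{0..1}. \<bar>g r x\<bar> \<le> C"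
  shows "(\<integral>w. (\<Prod>r\<in>insert t J. g r (w r)) \<partial>P) =
    (\<integral>w. (\<Prod>r\<in>J. (g(Max J := \<lambda>x. g (Max J) x * affine_form (g t) t x)) r (w r)) \<partial>P)"
proof -
  let ?s = "Max J" and ?f = "\<lambda>w. \<Prod>r\<in>J. g r (w r)"
  have s: "?s \<in> J" using J(1,2) by (rule Max_in)
  have st: "?s \<le> t" using J(3)[OF s] by (rule less_imp_le)
  have f1: "?f \<in> borel_measurable (path_filtration T t0 ?s)"
    by (rule coordinate_functions_product(1)[where g = g, OF J(1) Max_ge[OF J(1)] g(1) g(2)])
  have f2: "integrable P ?f"
    by (rule coordinate_functions_product(2)[where g = g, OF J(1) Max_ge[OF J(1)] g(1) g(2)])
  have "(\<integral>w. (\<Prod>r\<in>insert t J. g r (w r)) \<partial>P) = (\<integral>w. ?f w * g t (w t) \<partial>P)"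
  proof -
    have "t \<notin> J" using J(3) by blast
    then show ?thesis using J(1) by (simp add: mult.commute)
  qed
  also have "\<dots> = (\<integral>w. ?f w * affine_form (g t) t (w ?s) \<partial>P)"
    by (rule integral_mult_two_point[OF st f1 f2 g(1)])
  also have "\<dots> = (\<integral>w. (\<Prod>r\<in>J. (g(?s := \<lambda>x. g ?s x * affine_form (g t) t x)) r (w r)) \<partial>P)"
  proof (intro Bochner_Integration.integral_cong refl)
    fix w :: "real \<Rightarrow> real"
    let ?h = "\<lambda>r. (g(?s := \<lambda>x. g ?s x * affine_form (g t) t x)) r (w r)"
    have "(\<Prod>r\<in>J - {?s}. ?h r) = (\<Prod>r\<in>J - {?s}. g r (w r))"
      by (intro prod.cong) auto
    then show "?f w * affine_form (g t) t (w ?s) = (\<Prod>r\<in>J. ?h r)"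
      unfolding prod.remove[OF J(1) s, of "\<lambda>r. g r (w r)"] prod.remove[OF J(1) s, of ?h]
      by simp
  qed
  finally show ?thesis .
qed

lemma integral_two_point:
  assumes "g \<in> borel_measurable borel"
  shows "(\<integral>w. g (w t) \<partial>P) = affine_form g t p0"
proof -
  have "(\<integral>w. 1 * g (w t) \<partial>P) = (\<integral>w. 1 * affine_form g t (w t) \<partial>P)"
    by (rule integral_mult_two_point[OF order_refl]) (use assms in auto)
  moreover have "integrable P (\<lambda>w. 1 * w t)"
    by (rule integral_mult_coord(1)[OF order_refl]) auto
  ultimately show ?thesis
    by (simp add: affine_form_def prob_space integral_coord)
qed

end

text \<open>Removing the times from last to first ends in an expression in \<open>p0\<close> and the
  corridor alone. Indicators as factors give the probabilities of cylinders, an intersection-stable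
  generator.\<close>

lemma two_point_martingale_unique:
  assumes "two_point_martingale a b p0 T t0 P" "two_point_martingale a b p0 T t0 Q"
  shows "P = Q"
proof -
  interpret P: two_point_martingale a b p0 T t0 P by fact
  interpret Q: two_point_martingale a b p0 T t0 Q by fact
  \<comment> \<open>Indicators alone would not close the induction, since each step multiplies a
    factor by an affine function.\<close>
  have eq: "(\<integral>w. (\<Prod>r\<in>J. g r (w r)) \<partial>P) = (\<integral>w. (\<Prod>r\<in>J. g r (w r)) \<partial>Q)"
    if "finite J" "\<And>r. g r \<in> borel_measurable borel" "\<And>r. \<exists>C. \<forall>x\<in>{0..1}. \<bar>g r x\<bar> \<le> C"
    for J :: "real set" and g :: "real \<Rightarrow> real \<Rightarrow> real"
    using that
  proof (induction J arbitrary: g rule: finite_linorder_max_induct)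
    case empty
    then show ?case by (simp add: P.prob_space Q.prob_space)
  next
    case (insert t J)
    show ?case
    proof (cases "J = {}")
      case True
      then show ?thesis
        using P.integral_two_point[of "g t" t] Q.integral_two_point[of "g t" t] insert.prems(1) by simp
    next
      case False
      let ?g = "g(Max J := \<lambda>x. g (Max J) x * P.affine_form (g t) t x)"
      have "?g r \<in> borel_measurable borel" for r
        using insert.prems(1) unfolding P.affine_form_def[abs_def]
        by (cases "r = Max J") (simp_all add: borel_measurable_times)
      moreover have "\<exists>C. \<forall>x\<in>{0..1}. \<bar>?g r x\<bar> \<le> C" for r
      proof (cases "r = Max J")
        case True
        obtain C where C: "\<forall>x\<in>{0..1}. \<bar>g (Max J) x\<bar> \<le> C" using insert.prems(2) by blast
        obtain c d where cd: "\<And>x. P.affine_form (g t) t x = c + d * x"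
          by (rule that) (rule P.affine_form_def)
        have "\<bar>?g r x\<bar> \<le> C * (\<bar>c\<bar> + \<bar>d\<bar>)" if "x \<in> {0..1}" for x
        proof -
          have "\<bar>d * x\<bar> \<le> \<bar>d\<bar>" using that by (simp add: abs_mult mult_left_le)
          then have "\<bar>c + d * x\<bar> \<le> \<bar>c\<bar> + \<bar>d\<bar>" by linarith
          then show ?thesis
            using C that True by (auto simp: abs_mult cd intro!: mult_mono)
        qed
        then show ?thesis by blast
      qed (use insert.prems(2) in auto)
      ultimately have "(\<integral>w. (\<Prod>r\<in>J. ?g r (w r)) \<partial>P) = (\<integral>w. (\<Prod>r\<in>J. ?g r (w r)) \<partial>Q)"
        by (rule insert.IH[of ?g])
      then show ?thesis
        using P.integral_product_insert[where g = g, OF insert.hyps(1) False bspec[OF insert.hyps(2)] insert.prems]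
          Q.integral_product_insert[where g = g, OF insert.hyps(1) False bspec[OF insert.hyps(2)] insert.prems]
        by simp
    qed
  qed
  let ?\<Omega> = "path_space T t0"
  let ?cyl = "\<lambda>J A. {w \<in> ?\<Omega>. \<forall>t\<in>J. w t \<in> A t}"
  define E where "E = {?cyl J A | (J :: real set) (A :: real \<Rightarrow> real set). finite J \<and> (\<forall>t. A t \<in> sets borel)}"
  have E_I: "?cyl J A \<in> E" if "finite J" "\<And>t. A t \<in> sets borel" for J A
    unfolding E_def using that by (intro CollectI exI[of _ J] exI[of _ A]) simp
  have E_D: "\<exists>J A. X = ?cyl J A \<and> finite J \<and> (\<forall>t. A t \<in> sets borel)" if "X \<in> E" for X
    using that unfolding E_def by (rule CollectD)
  let ?G = "{(\<lambda>w. w s) -` A \<inter> ?\<Omega> | s A. s \<in> UNIV \<and> A \<in> sets (borel :: real measure)}"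
  have sets_E: "sigma_sets ?\<Omega> ?G = sigma_sets ?\<Omega> E"
  proof (rule sigma_sets_eqI)
    fix X assume "X \<in> ?G"
    then obtain s and A :: "real set" where X: "X = (\<lambda>w. w s) -` A \<inter> ?\<Omega>" "A \<in> sets borel" by blast
    have "X = ?cyl {s} (\<lambda>_. A)" unfolding X(1) by auto
    also have "\<dots> \<in> E" using X(2) by (intro E_I) auto
    finally show "X \<in> sigma_sets ?\<Omega> E" by (rule sigma_sets.Basic)
  next
    fix X assume "X \<in> E"
    from E_D[OF \<open>X \<in> E\<close>] obtain J A where
      "X = ?cyl J A \<and> finite J \<and> (\<forall>t. A t \<in> sets borel)"
      by (elim exE)
    then have X: "X = ?cyl J A" "finite J" "\<And>t. A t \<in> sets borel"
      by simp_all
    have "{w \<in> space (coord_algebra T t0 UNIV). \<forall>t\<in>J. w t \<in> A t} \<in> sets (coord_algebra T t0 UNIV)"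
    proof (rule sets.sets_Collect_finite_All[OF _ X(2)])
      fix t
      have "{w \<in> space (coord_algebra T t0 UNIV). w t \<in> A t} =
          (\<lambda>w. w t) -` A t \<inter> space (coord_algebra T t0 UNIV)" by auto
      then show "{w \<in> space (coord_algebra T t0 UNIV). w t \<in> A t} \<in> sets (coord_algebra T t0 UNIV)"
        using measurable_sets[OF measurable_coordinate[OF UNIV_I] X(3)] by simp
    qed
    then show "X \<in> sigma_sets ?\<Omega> ?G"
      unfolding X(1) sets_coord_algebra[symmetric] by simp
  qed
  show "P = Q"
  proof (rule measure_eqI_generator_eq[where E = E and \<Omega> = ?\<Omega> and A = "\<lambda>_. ?\<Omega>"])
    show "Int_stable E"
    proof (rule Int_stableI)
      fix X Y assume "X \<in> E" "Y \<in> E"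
      from E_D[OF \<open>X \<in> E\<close>] obtain J A where
      "X = ?cyl J A \<and> finite J \<and> (\<forall>t. A t \<in> sets borel)"
      by (elim exE)
    then have X: "X = ?cyl J A" "finite J" "\<And>t. A t \<in> sets borel"
      by simp_all
      from E_D[OF \<open>Y \<in> E\<close>] obtain K B where
      "Y = ?cyl K B \<and> finite K \<and> (\<forall>t. B t \<in> sets borel)"
      by (elim exE)
    then have Y: "Y = ?cyl K B" "finite K" "\<And>t. B t \<in> sets borel"
      by simp_all
      let ?C = "\<lambda>t. (if t \<in> J then A t else UNIV) \<inter> (if t \<in> K then B t else UNIV)"
      have "X \<inter> Y = ?cyl (J \<union> K) ?C"
        unfolding X(1) Y(1) by (auto split: if_splits)
      also have "\<dots> \<in> E"
        by (rule E_I) (use X Y in auto)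
      finally show "X \<inter> Y \<in> E" .
    qed
    show "sets P = sigma_sets ?\<Omega> E" "sets Q = sigma_sets ?\<Omega> E"
      unfolding sets_E[symmetric] P.sets_P Q.sets_P path_algebra_def sets_coord_algebra by simp_all
    fix X assume "X \<in> E"
    from E_D[OF \<open>X \<in> E\<close>] obtain J A where
      "X = ?cyl J A \<and> finite J \<and> (\<forall>t. A t \<in> sets borel)"
      by (elim exE)
    then have X: "X = ?cyl J A" "finite J" "\<And>t. A t \<in> sets borel"
      by simp_all
    note [measurable] = X(3)
    have XP: "X \<in> sets P"
      using \<open>X \<in> E\<close> by (simp add: \<open>sets P = sigma_sets ?\<Omega> E\<close> sigma_sets.Basic)
    then have XQ: "X \<in> sets Q"
      by (simp add: P.sets_P Q.sets_P)
    have *: "indicator X w = (\<Prod>r\<in>J. indicator (A r) (w r) :: real)" if "w \<in> ?\<Omega>" for w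
      using X(2) that by (auto simp: X(1) indicator_def prod_eq_1_iff intro!: prod_zero)
    have "measure P X = (\<integral>w. (\<Prod>r\<in>J. indicator (A r) (w r)) \<partial>P)"
    proof -
      have "measure P X = (\<integral>w. indicator X w \<partial>P)" using XP by simp
      also have "\<dots> = (\<integral>w. (\<Prod>r\<in>J. indicator (A r) (w r)) \<partial>P)"
        by (intro Bochner_Integration.integral_cong refl *) (simp add: P.space_P)
      finally show ?thesis .
    qed
    also have "\<dots> = (\<integral>w. (\<Prod>r\<in>J. indicator (A r) (w r)) \<partial>Q)"
      by (rule eq[OF X(2), of "\<lambda>r. indicator (A r)"]) (auto intro!: exI[of _ 1] simp: indicator_def)
    also have "\<dots> = measure Q X"
    proof -
      have "measure Q X = (\<integral>w. indicator X w \<partial>Q)" using XQ by simp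
      also have "\<dots> = (\<integral>w. (\<Prod>r\<in>J. indicator (A r) (w r)) \<partial>Q)"
        by (intro Bochner_Integration.integral_cong refl *) (simp add: Q.space_P)
      finally show ?thesis by simp
    qed
    finally show "emeasure P X = emeasure Q X"
      by (simp add: P.emeasure_eq_measure Q.emeasure_eq_measure)
  next
    have "?\<Omega> = ?cyl {} (\<lambda>_. UNIV)" by simp
    also have "\<dots> \<in> E" by (rule E_I) auto
    finally show "range (\<lambda>_::nat. ?\<Omega>) \<subseteq> E" by auto
  next
    show "E \<subseteq> Pow ?\<Omega>" unfolding E_def by blast
  qed (auto simp: P.emeasure_eq_measure)
qed

section \<open>The Hamiltonian and its convex hull\<close>

text \<open>Uniform continuity on the compact product gives a modulus independent of the point of
  \<open>W\<close>, and this modulus passes to the supremum.\<close>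

lemma continuous_on_SUP_compact:
  fixes F :: "'a::metric_space \<Rightarrow> 'b::metric_space \<Rightarrow> real"
  assumes "compact K" "compact W" "W \<noteq> {}" "continuous_on (K \<times> W) (\<lambda>(x, w). F x w)"
  shows "continuous_on K (\<lambda>x. SUP w\<in>W. F x w)"
  unfolding continuous_on_iff
proof (intro ballI allI impI)
  fix x and e :: real assume x: "x \<in> K" and e: "0 < e"
  have "uniformly_continuous_on (K \<times> W) (\<lambda>(x, w). F x w)"
    using assms by (intro compact_uniformly_continuous compact_Times)
  \<comment> \<open>Half of \<open>e\<close>, because the supremum preserves only weak
    inequalities.\<close>
  moreover have "0 < e / 2" using e by simp
  ultimately obtain d where d: "0 < d"
      "\<And>z z'. \<lbrakk>z \<in> K \<times> W; z' \<in> K \<times> W; dist z' z < d\<rbrakk> \<Longrightarrow>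
        dist (case z' of (x, w) \<Rightarrow> F x w) (case z of (x, w) \<Rightarrow> F x w) < e / 2"
    unfolding uniformly_continuous_on_def by blast
  have bdd: "bdd_above (F y ` W)" if "y \<in> K" for y
  proof -
    have "continuous_on W ((\<lambda>(x, w). F x w) \<circ> Pair y)"
      using that by (intro continuous_on_compose continuous_intros continuous_on_subset[OF assms(4)]) auto
    then have "continuous_on W (F y)" by (simp add: comp_def)
    then show ?thesis
      using assms(2) by (intro bounded_imp_bdd_above compact_imp_bounded compact_continuous_image)
  qed
  have le: "(SUP w\<in>W. F y w) \<le> (SUP w\<in>W. F z w) + e / 2" if "y \<in> K" "z \<in> K" "dist y z < d" for y z
  proof (rule cSUP_least[OF assms(3)])
    fix w assume w: "w \<in> W"
    have "dist (F y w) (F z w) < e / 2"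
      using d(2)[of "(z, w)" "(y, w)"] that w by (simp add: dist_Pair_Pair)
    then have "F y w \<le> F z w + e / 2" unfolding dist_real_def by linarith
    also have "F z w \<le> (SUP w\<in>W. F z w)"
      by (rule cSUP_upper[OF w bdd[OF that(2)]])
    finally show "F y w \<le> (SUP w\<in>W. F z w) + e / 2" by simp
  qed
  show "\<exists>d>0. \<forall>x'\<in>K. dist x' x < d \<longrightarrow> dist (SUP w\<in>W. F x' w) (SUP w\<in>W. F x w) < e"
  proof (intro exI[of _ d] conjI ballI impI d(1))
    fix y assume y: "y \<in> K" "dist y x < d"
    show "dist (SUP w\<in>W. F y w) (SUP w\<in>W. F x w) < e"
      using le[OF y(1) x y(2)] le[OF x y(1)] y(2) e by (simp add: dist_real_def dist_commute abs_if)
  qed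
qed

text \<open>The supremum lemma is applied twice: to the inner supremum with parameters (t, p, u),
  then to the outer infimum written as a negated supremum of negated values.\<close>

lemma continuous_on_hamiltonian:
  fixes U :: "'u::metric_space set" and V :: "'v::metric_space set"
  assumes U: "compact U" "U \<noteq> {}" and V: "compact V" "V \<noteq> {}"
    and l: "continuous_on ({0..T} \<times> U \<times> V) (\<lambda>(t, u, v). l1 t u v)"
      "continuous_on ({0..T} \<times> U \<times> V) (\<lambda>(t, u, v). l2 t u v)"
  shows "continuous_on ({0..T} \<times> {0..1}) (\<lambda>(t, p). hamiltonian l1 l2 U V t p)"
proof -
  let ?L = "\<lambda>x v. fst (snd x) * l1 (fst x) (snd (snd x)) v + (1 - fst (snd x)) * l2 (fst x) (snd (snd x)) v"
  have c: "continuous_on (({0..T} \<times> {0..1::real} \<times> U) \<times> V)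
      (\<lambda>z. k (fst (fst z)) (snd (snd (fst z))) (snd z))"
    if "continuous_on ({0..T} \<times> U \<times> V) (\<lambda>(t, u, v). k t u v)" for k :: "real \<Rightarrow> 'u \<Rightarrow> 'v \<Rightarrow> real"
  proof -
    have "continuous_on (({0..T} \<times> {0..1::real} \<times> U) \<times> V)
        ((\<lambda>(t, u, v). k t u v) \<circ> (\<lambda>z. (fst (fst z), snd (snd (fst z)), snd z)))"
      by (intro continuous_on_compose continuous_intros continuous_on_subset[OF that]) auto
    then show ?thesis by (simp add: comp_def)
  qed
  have "continuous_on (({0..T} \<times> {0..1} \<times> U) \<times> V) (\<lambda>(x, v). ?L x v)"
    unfolding split_beta by (intro continuous_intros c l)
  then have "continuous_on ({0..T} \<times> {0..1} \<times> U) (\<lambda>x. SUP v\<in>V. ?L x v)"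
    using U V by (intro continuous_on_SUP_compact compact_Times) auto
  then have 1: "continuous_on ({0..T} \<times> {0..1} \<times> U) (\<lambda>x. - (SUP v\<in>V. ?L x v))"
    by (rule continuous_on_minus)
  have "continuous_on (({0..T} \<times> {0..1}) \<times> U)
      ((\<lambda>x. - (SUP v\<in>V. ?L x v)) \<circ> (\<lambda>z. (fst (fst z), snd (fst z), snd z)))"
    by (intro continuous_on_compose continuous_intros continuous_on_subset[OF 1]) auto
  then have "continuous_on (({0..T} \<times> {0..1}) \<times> U)
      (\<lambda>(x, u). - (SUP v\<in>V. snd x * l1 (fst x) u v + (1 - snd x) * l2 (fst x) u v))"
    by (simp add: comp_def split_beta)
  then have "continuous_on ({0..T} \<times> {0..1})
      (\<lambda>x. SUP u\<in>U. - (SUP v\<in>V. snd x * l1 (fst x) u v + (1 - snd x) * l2 (fst x) u v))"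
    using U by (intro continuous_on_SUP_compact compact_Times) auto
  from continuous_on_minus[OF this] show ?thesis
    unfolding hamiltonian_def Inf_real_def image_image split_beta .
qed

section \<open>Supporting lines and their contact sets\<close>

text \<open>If f were affine on one side of \<open>q\<close>, then \<open>f'\<close> would be
  constant there and its one-sided derivative at \<open>q\<close> would be 0. Only the side towards
  \<open>x\<close> is used, which also covers the end points 0 and 1.\<close>

lemma not_locally_affine:
  assumes d2: "has_second_derivative_within f d q {0..1}" and d: "0 < d"
    and q: "q \<in> {0..1}" and x: "x \<in> {0..1}" "x \<noteq> q"
    and aff: "\<forall>\<^sub>F r in nhds q. r \<in> {min q x<..<max q x} \<longrightarrow> f r = \<alpha> + \<beta> * r"
  shows False
proof -
  let ?S = "{min q x<..<max q x}"
  obtain f' where f': "\<forall>\<^sub>F r in nhds q. r \<in> {0..1} \<longrightarrow> (f has_real_derivative f' r) (at r within {0..1})"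
    and f'': "(f' has_real_derivative d) (at q within {0..1})"
    using d2 unfolding has_second_derivative_within_def by blast
  have S: "?S \<subseteq> {0..1}" using q x by auto
  have "q islimpt ?S"
    using x(2) islimpt_greaterThanLessThan1[of q x] islimpt_greaterThanLessThan2[of x q]
    by (cases "q < x") (auto simp: min_def max_def)
  then have nontriv: "at q within ?S \<noteq> bot"
    by (simp add: trivial_limit_within)
  obtain A where A: "open A" "q \<in> A" "\<And>r. r \<in> A \<Longrightarrow> r \<in> ?S \<Longrightarrow> f r = \<alpha> + \<beta> * r"
    using aff unfolding eventually_nhds by blast
  obtain B where B: "open B" "q \<in> B" "\<And>r. r \<in> B \<Longrightarrow> r \<in> {0..1} \<Longrightarrow> (f has_real_derivative f' r) (at r within {0..1})"
    using f' unfolding eventually_nhds by blast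
  have eq: "f' r = \<beta>" if r: "r \<in> A" "r \<in> B" "r \<in> ?S" for r
  proof -
    have "(f has_real_derivative f' r) (at r within ?S)"
      using B(3)[of r] r S by (blast intro: DERIV_subset)
    then have "(f has_real_derivative f' r) (at r)"
      using r(3) by (simp add: at_within_open[OF _ open_greaterThanLessThan])
    moreover have "(f has_real_derivative \<beta>) (at r)"
    proof (rule has_field_derivative_transform_within_open[of "\<lambda>r. \<alpha> + \<beta> * r" _ _ "A \<inter> ?S"])
      show "((\<lambda>r. \<alpha> + \<beta> * r) has_real_derivative \<beta>) (at r)"
        by (auto intro!: derivative_eq_intros)
    qed (use A r in auto)
    ultimately show ?thesis by (rule DERIV_unique)
  qed
  have ev: "\<forall>\<^sub>F r in at q within ?S. f' r = \<beta>"
    unfolding eventually_at_filter eventually_nhds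
    using A B eq by (intro exI[of _ "A \<inter> B"]) auto
  have f''S: "(f' has_real_derivative d) (at q within ?S)"
    using f'' S by (rule DERIV_subset)
  \<comment> \<open>The open interval \<open>?S\<close> omits \<open>q\<close>, so the value of
    \<open>f'\<close> at \<open>q\<close> has to come from its continuity there.\<close>
  have "(f' \<longlongrightarrow> f' q) (at q within ?S)"
    using DERIV_continuous[OF f''S] by (simp add: continuous_within)
  moreover have "(f' \<longlongrightarrow> \<beta>) (at q within ?S)"
    using ev by (rule tendsto_eventually)
  ultimately have f'q: "f' q = \<beta>"
    by (rule tendsto_unique[OF nontriv])
  have "\<forall>\<^sub>F r in at q within ?S. (f' r - f' q) / (r - q) = 0"
    using ev by eventually_elim (simp add: f'q)
  then have "((\<lambda>r. (f' r - f' q) / (r - q)) \<longlongrightarrow> 0) (at q within ?S)"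
    by (rule tendsto_eventually)
  moreover have "((\<lambda>r. (f' r - f' q) / (r - q)) \<longlongrightarrow> d) (at q within ?S)"
    using f''S by (simp add: has_field_derivative_iff)
  ultimately have "d = 0"
    using tendsto_unique[OF nontriv] by blast
  with d show False by simp
qed

lemma convex_on_le_affine:
  fixes g :: "real \<Rightarrow> real"
  assumes g: "convex_on {0..1} g" and xy: "x \<in> {0..1}" "y \<in> {0..1}" "x \<le> r" "r \<le> y"
    and le: "g x \<le> \<alpha> + \<beta> * x" "g y \<le> \<alpha> + \<beta> * y"
  shows "g r \<le> \<alpha> + \<beta> * r"
proof (cases "x = y")
  case False
  define l where "l = (r - x) / (y - x)"
  have l: "0 \<le> l" "l \<le> 1"
    using xy False by (auto simp: l_def field_simps)
  have "l * (y - x) = r - x"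
    using False by (simp add: l_def)
  then have r: "r = (1 - l) * x + l * y"
    by (simp add: algebra_simps)
  have "g r \<le> (1 - l) * g x + l * g y"
    using convex_onD[OF g l xy(1,2)] r by simp
  also have "\<dots> \<le> (1 - l) * (\<alpha> + \<beta> * x) + l * (\<alpha> + \<beta> * y)"
    using l le by (intro add_mono mult_left_mono) auto
  also have "\<dots> = \<alpha> + \<beta> * r" unfolding r by (simp add: algebra_simps)
  finally show ?thesis .
qed (use xy le in auto)

text \<open>Slopes of chords from \<open>p\<close> are monotone, so the slope towards
  \<open>x\<close> bounds their limit \<open>c\<close>. Only the limit from the side of
  \<open>x\<close> enters, hence \<open>p\<close> may be an end point.\<close>

lemma convex_on_above_tangent:
  fixes g :: "real \<Rightarrow> real"
  assumes g: "convex_on {0..1} g" and p: "p \<in> {0..1}" and x: "x \<in> {0..1}"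
    and c: "(g has_real_derivative c) (at p within {0..1})"
  shows "g p + c * (x - p) \<le> g x"
proof (cases "x = p")
  case False
  let ?S = "{min p x<..<max p x}"
  have "p islimpt ?S"
    using False islimpt_greaterThanLessThan1[of p x] islimpt_greaterThanLessThan2[of x p]
    by (cases "p < x") (auto simp: min_def max_def)
  then have nontriv: "at p within ?S \<noteq> bot"
    by (simp add: trivial_limit_within)
  have "(g has_real_derivative c) (at p within ?S)"
    by (rule DERIV_subset[OF c]) (use p x in auto)
  then have lim: "((\<lambda>r. (g r - g p) / (r - p)) \<longlongrightarrow> c) (at p within ?S)"
    by (simp add: has_field_derivative_iff)
  have S: "\<forall>\<^sub>F r in at p within ?S. r \<in> ?S"
    by (simp add: eventually_at_filter)
  have sym: "(g u - g v) / (u - v) = (g v - g u) / (v - u)" for u v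
    by (metis minus_diff_eq minus_divide_divide)
  show ?thesis
  proof (cases "p < x")
    case True
    have "\<forall>\<^sub>F r in at p within ?S. (g r - g p) / (r - p) \<le> (g x - g p) / (x - p)"
      using S
    proof eventually_elim
      case (elim r)
      then have "p < r" "r < x" using True by auto
      then show ?case
        using convex_on_slope_le(1)[OF g p x, of r] sym[of p r] sym[of p x] by simp
    qed
    then have "c \<le> (g x - g p) / (x - p)"
      by (rule tendsto_upperbound[OF lim _ nontriv])
    then show ?thesis using True by (simp add: field_simps)
  next
    case F: False
    then have "x < p" using False by simp
    have "\<forall>\<^sub>F r in at p within ?S. (g x - g p) / (x - p) \<le> (g r - g p) / (r - p)"
      using S
    proof eventually_elim
      case (elim r)
      then have "x < r" "r < p" using \<open>x < p\<close> by auto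
      then show ?case
        using convex_on_slope_le(2)[OF g x p, of r] by simp
    qed
    then have "(g x - g p) / (x - p) \<le> c"
      by (rule tendsto_lowerbound[OF lim _ nontriv])
    then show ?thesis using \<open>x < p\<close> by (simp add: field_simps)
  qed
qed simp

lemma affine_convex_on: "convex_on {0..1} (\<lambda>x::real. \<alpha> + \<beta> * x)"
  by (rule convex_onI) (auto simp: algebra_simps)

text \<open>If the maximal line below \<open>f\<close> through \<open>(x0, v)\<close> did not touch \<open>f\<close> to the left of \<open>x0\<close>, it could be
  tilted around a point to the right of \<open>x0\<close> so as to pass above \<open>(x0, v)\<close>.\<close>

lemma maximal_line_touches_left:
  fixes f :: "real \<Rightarrow> real"
  assumes f: "continuous_on {0..1} f" and x0: "0 \<le> x0" "x0 < 1"
    and below: "\<And>x. x \<in> {0..1} \<Longrightarrow> \<alpha> + \<beta> * x \<le> f x"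
    and max: "\<And>\<alpha>' \<beta>'. (\<And>x. x \<in> {0..1} \<Longrightarrow> \<alpha>' + \<beta>' * x \<le> f x) \<Longrightarrow> \<alpha>' + \<beta>' * x0 \<le> \<alpha> + \<beta> * x0"
  shows "\<exists>y\<in>{0..x0}. f y = \<alpha> + \<beta> * y"
proof (rule ccontr)
  assume no: "\<not> ?thesis"
  let ?\<phi> = "\<lambda>x. f x - (\<alpha> + \<beta> * x)"
  have c: "continuous_on {0..1} ?\<phi>"
    by (intro continuous_intros f)
  have pos: "0 < ?\<phi> x" if "x \<in> {0..x0}" for x
    using no below[of x] that x0 by force
  obtain \<delta> where \<delta>: "0 < \<delta>" "\<And>x. x \<in> {0..1} \<Longrightarrow> dist x x0 < \<delta> \<Longrightarrow> dist (?\<phi> x) (?\<phi> x0) < ?\<phi> x0"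
    using c[unfolded continuous_on_iff, rule_format, of x0 "?\<phi> x0"] pos[of x0] x0 by auto
  define z where "z = min 1 (x0 + \<delta> / 2)"
  have z: "x0 < z" "z \<le> 1" "z \<le> x0 + \<delta> / 2" using x0 \<delta>(1) by (auto simp: z_def)
  have posz: "0 < ?\<phi> x" if "x \<in> {0..z}" for x
  proof (cases "x \<le> x0")
    case False
    then have "dist x x0 < \<delta>" using that z \<delta>(1) by (auto simp: dist_real_def)
    then have "dist (?\<phi> x) (?\<phi> x0) < ?\<phi> x0" using \<delta>(2)[of x] that z by auto
    then show ?thesis by (auto simp: dist_real_def abs_if split: if_splits)
  qed (use pos that in auto)
  have "\<exists>x\<in>{0..z}. \<forall>y\<in>{0..z}. ?\<phi> x \<le> ?\<phi> y"
    using z x0 by (intro continuous_attains_inf continuous_on_subset[OF c]) auto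
  then obtain y where y: "y \<in> {0..z}" "\<And>x. x \<in> {0..z} \<Longrightarrow> ?\<phi> y \<le> ?\<phi> x" by blast
  define \<epsilon> where "\<epsilon> = ?\<phi> y"
  have \<epsilon>: "0 < \<epsilon>" unfolding \<epsilon>_def using posz y(1) by blast
  \<comment> \<open>The tilted line gains \<open>\<epsilon> * (z - x)\<close>: at most the minimal
    gap \<open>\<epsilon>\<close> on \<open>{0..z}\<close>, nothing beyond \<open>z\<close>, but a
    positive amount at \<open>x0\<close>.\<close>
  have "(\<alpha> + \<epsilon> * z) + (\<beta> - \<epsilon>) * x0 \<le> \<alpha> + \<beta> * x0"
  proof (rule max)
    fix x :: real assume x: "x \<in> {0..1}"
    show "(\<alpha> + \<epsilon> * z) + (\<beta> - \<epsilon>) * x \<le> f x"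
    proof (cases "x \<le> z")
      case True
      have "\<epsilon> * (z - x) \<le> \<epsilon> * 1" using \<epsilon> x z by (intro mult_left_mono) auto
      also have "\<dots> \<le> ?\<phi> x" using y(2)[of x] x True by (simp add: \<epsilon>_def)
      finally show ?thesis by (simp add: algebra_simps)
    next
      case False
      then have "\<epsilon> * (z - x) \<le> 0" using \<epsilon> by (intro mult_nonneg_nonpos) auto
      then show ?thesis using below[OF x] by (simp add: algebra_simps)
    qed
  qed
  moreover have "0 < \<epsilon> * (z - x0)" using \<epsilon> z by simp
  ultimately show False by (simp add: algebra_simps)
qed

text \<open>Mirror image of the left case under x -> 1 - x, which turns the intercept into
  \<open>\<alpha> + \<beta>\<close> and the slope into \<open>- \<beta>\<close>.\<close>

lemma maximal_line_touches_right:
  fixes f :: "real \<Rightarrow> real"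
  assumes f: "continuous_on {0..1} f" and x0: "0 < x0" "x0 \<le> 1"
    and below: "\<And>x. x \<in> {0..1} \<Longrightarrow> \<alpha> + \<beta> * x \<le> f x"
    and max: "\<And>\<alpha>' \<beta>'. (\<And>x. x \<in> {0..1} \<Longrightarrow> \<alpha>' + \<beta>' * x \<le> f x) \<Longrightarrow> \<alpha>' + \<beta>' * x0 \<le> \<alpha> + \<beta> * x0"
  shows "\<exists>y\<in>{x0..1}. f y = \<alpha> + \<beta> * y"
proof -
  have "\<exists>y\<in>{0..1 - x0}. f (1 - y) = (\<alpha> + \<beta>) + (- \<beta>) * y"
  proof (rule maximal_line_touches_left)
    show "continuous_on {0..1} (\<lambda>x. f (1 - x))"
      by (rule continuous_on_compose2[OF f]) (auto intro!: continuous_intros)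
    show "(\<alpha> + \<beta>) + (- \<beta>) * x \<le> f (1 - x)" if "x \<in> {0..1}" for x
      using below[of "1 - x"] that by (simp add: algebra_simps)
    fix \<alpha>' \<beta>' assume *: "\<And>x. x \<in> {0..1} \<Longrightarrow> \<alpha>' + \<beta>' * x \<le> f (1 - x)"
    have "(\<alpha>' + \<beta>') + (- \<beta>') * x0 \<le> \<alpha> + \<beta> * x0"
    proof (rule max)
      fix x :: real assume "x \<in> {0..1}"
      then show "(\<alpha>' + \<beta>') + (- \<beta>') * x \<le> f x"
        using *[of "1 - x"] by (simp add: algebra_simps)
    qed
    then show "\<alpha>' + \<beta>' * (1 - x0) \<le> (\<alpha> + \<beta>) + (- \<beta>) * (1 - x0)"
      by (simp add: algebra_simps)
  qed (use x0 in auto)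
  then obtain y where "y \<in> {0..1 - x0}" "f (1 - y) = (\<alpha> + \<beta>) + (- \<beta>) * y" by blast
  then show ?thesis
    by (intro bexI[of _ "1 - y"]) (auto simp: algebra_simps)
qed

context
  fixes f :: "real \<Rightarrow> real" and k1 k2 :: real
  assumes f: "continuous_on {0..1} f"
    and k: "0 \<le> k1" "k1 \<le> k2" "k2 \<le> 1"
    and vex: "\<And>p. p \<in> {0..1} \<Longrightarrow> Vex f p = f p \<longleftrightarrow> p \<in> {0..k1} \<union> {k2..1}"
    and d2: "\<And>p. p \<in> {0..<k1} \<union> {k2<..1} \<Longrightarrow> \<exists>d>0. has_second_derivative_within f d p {0..1}"
begin

lemma Vex_convex: "convex_on {0..1} (Vex f)"
  and Vex_le: "q \<in> {0..1} \<Longrightarrow> Vex f q \<le> f q"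
  and le_Vex: "\<lbrakk>\<And>q. q \<in> {0..1} \<Longrightarrow> \<alpha> + \<beta> * q \<le> f q; q \<in> {0..1}\<rbrakk> \<Longrightarrow> \<alpha> + \<beta> * q \<le> Vex f q"
proof -
  have "\<exists>x\<in>{0..1::real}. \<forall>y\<in>{0..1}. f x \<le> f y"
    using f by (intro continuous_attains_inf) auto
  then obtain m where m: "\<And>q. q \<in> {0..1} \<Longrightarrow> m \<le> f q" by blast
  show "convex_on {0..1} (Vex f)" "q \<in> {0..1} \<Longrightarrow> Vex f q \<le> f q"
    using Vex_largest(1,2)[of m f] m by blast+
  show "\<lbrakk>\<And>q. q \<in> {0..1} \<Longrightarrow> \<alpha> + \<beta> * q \<le> f q; q \<in> {0..1}\<rbrakk> \<Longrightarrow> \<alpha> + \<beta> * q \<le> Vex f q"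
    using Vex_largest(3)[of m f "\<lambda>q. \<alpha> + \<beta> * q" q] m affine_convex_on by blast
qed

text \<open>Between two contact points the hull is squeezed: convexity keeps it below the chord, and
  the line is itself a convex minorant.\<close>

lemma touching_affine_on_segment:
  assumes below: "\<And>x. x \<in> {0..1} \<Longrightarrow> \<alpha> + \<beta> * x \<le> f x"
    and xy: "x \<in> {0..1}" "y \<in> {0..1}" "f x = \<alpha> + \<beta> * x" "f y = \<alpha> + \<beta> * y" and r: "x \<le> r" "r \<le> y"
  shows "Vex f r = \<alpha> + \<beta> * r"
proof (rule antisym)
  show "Vex f r \<le> \<alpha> + \<beta> * r"
    using Vex_le[OF xy(1)] Vex_le[OF xy(2)] xy(3,4)
    by (intro convex_on_le_affine[OF Vex_convex xy(1,2) r]) simp_all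
  show "\<alpha> + \<beta> * r \<le> Vex f r"
    using le_Vex[OF below] r xy by auto
qed

text \<open>With a second contact point the hull would coincide with the line between the two. Near
  \<open>q\<close> the function agrees with its hull, so it would be affine on one side of
  \<open>q\<close>, against the positive second derivative.\<close>

lemma not_affine_near:
  assumes q: "q \<in> {0..<k1} \<union> {k2<..1}" and x: "x \<in> {0..1}" "x \<noteq> q"
    and below: "\<And>x. x \<in> {0..1} \<Longrightarrow> \<alpha> + \<beta> * x \<le> f x"
    and touch: "f q = \<alpha> + \<beta> * q" "f x = \<alpha> + \<beta> * x"
  shows False
proof -
  have q01: "q \<in> {0..1}" using q k by auto
  obtain d where d: "0 < d" "has_second_derivative_within f d q {0..1}"
    using d2[OF q] by blast
  have "\<forall>\<^sub>F r in nhds q. r \<in> {0..1} \<longrightarrow> r \<in> {0..k1} \<union> {k2..1}"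
  proof (cases "q < k1")
    case True
    then have "\<forall>\<^sub>F r in nhds q. r < k1"
      by (intro eventually_nhds_in_open[of "{..<k1}", simplified]) auto
    then show ?thesis by eventually_elim auto
  next
    case False
    then have "\<forall>\<^sub>F r in nhds q. k2 < r"
      using q by (intro eventually_nhds_in_open[of "{k2<..}", simplified]) auto
    then show ?thesis by eventually_elim auto
  qed
  then have "\<forall>\<^sub>F r in nhds q. r \<in> {min q x<..<max q x} \<longrightarrow> f r = \<alpha> + \<beta> * r"
  proof eventually_elim
    case (elim r)
    show ?case
    proof
      assume r: "r \<in> {min q x<..<max q x}"
      then have r01: "r \<in> {0..1}" using q01 x by auto
      have "Vex f r = \<alpha> + \<beta> * r"
        using touching_affine_on_segment[OF below q01 x(1) touch, of r]
          touching_affine_on_segment[OF below x(1) q01 touch(2,1), of r] r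
        by (cases "q < x") auto
      moreover have "Vex f r = f r" using vex[OF r01] elim r01 by blast
      ultimately show "f r = \<alpha> + \<beta> * r" by simp
    qed
  qed
  from not_locally_affine[OF d(2,1) q01 x this] show False .
qed

text \<open>Near \<open>p\<close> the function agrees with its hull, so both have the same
  derivative there. Convexity puts the tangent below the hull on the whole interval, hence below
  \<open>f\<close>.\<close>

lemma tangent_line:
  assumes p: "p \<in> {0..<k1} \<union> {k2<..1}"
  shows "\<exists>\<alpha> \<beta>. \<forall>x\<in>{0..1}. \<alpha> + \<beta> * x \<le> f x \<and> (f x = \<alpha> + \<beta> * x \<longleftrightarrow> x = p)"
proof -
  have p01: "p \<in> {0..1}" and pv: "Vex f p = f p" using p k vex[of p] by auto
  obtain f' where "\<forall>\<^sub>F r in nhds p. r \<in> {0..1} \<longrightarrow> (f has_real_derivative f' r) (at r within {0..1})"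
    using d2[OF p] unfolding has_second_derivative_within_def by blast
  from eventually_nhds_x_imp_x[OF this] p01 obtain c where c: "(f has_real_derivative c) (at p within {0..1})"
    by blast
  have "(Vex f has_real_derivative c) (at p within {0..1})"
  proof (cases "p < k1")
    case True
    show ?thesis
    proof (rule has_field_derivative_transform_within[OF c _ p01])
      show "0 < k1 - p" using True by simp
      show "f x = Vex f x" if "x \<in> {0..1}" "dist x p < k1 - p" for x
        using vex[OF that(1)] that by (auto simp: dist_real_def)
    qed
  next
    case False
    show ?thesis
    proof (rule has_field_derivative_transform_within[OF c _ p01])
      show "0 < p - k2" using False p by auto
      show "f x = Vex f x" if "x \<in> {0..1}" "dist x p < p - k2" for x
        using vex[OF that(1)] that by (auto simp: dist_real_def)
    qed
  qed
  then have below: "(f p - c * p) + c * x \<le> f x" if "x \<in> {0..1}" for x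
    using convex_on_above_tangent[OF Vex_convex p01 that, of c] Vex_le[OF that] pv
    by (simp add: algebra_simps)
  have "x = p" if "x \<in> {0..1}" "f x = (f p - c * p) + c * x" for x
    using not_affine_near[OF p that(1) _ below _ that(2)] by auto
  then have "f x = (f p - c * p) + c * x \<longleftrightarrow> x = p" if "x \<in> {0..1}" for x
    using that by (metis diff_add_cancel)
  with below show ?thesis by blast
qed

text \<open>A supporting line of the hull at a point between \<open>k1\<close> and \<open>k2\<close>
  is maximal there among the lines below \<open>f\<close>, so it touches \<open>f\<close> on both
  sides. Contacts lie only in \<open>{0..k1} \<union> {k2..1}\<close> and the hull is affine between
  them, so the line passes through both corner points.\<close>

lemma chord_line:
  assumes lt: "k1 < k2"
  shows "\<exists>\<alpha> \<beta>. \<forall>x\<in>{0..1}. \<alpha> + \<beta> * x \<le> f x \<and> (f x = \<alpha> + \<beta> * x \<longleftrightarrow> x \<in> {k1, k2})"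
proof -
  define x0 where "x0 = (k1 + k2) / 2"
  have x0: "k1 < x0" "x0 < k2" "0 < x0" "x0 < 1" using lt k by (auto simp: x0_def)
  \<comment> \<open>The right derivative of the hull at \<open>x0\<close>, as the infimum of its
    right difference quotients.\<close>
  define \<beta> where "\<beta> = Inf ((\<lambda>t. (Vex f x0 - Vex f t) / (x0 - t)) ` ({x0<..} \<inter> {0..1}))"
  define \<alpha> where "\<alpha> = Vex f x0 - \<beta> * x0"
  have below_Vex: "\<alpha> + \<beta> * x \<le> Vex f x" if "x \<in> {0..1}" for x
    using convex_le_Inf_differential[OF Vex_convex, of x0 x] that x0
    by (simp add: \<alpha>_def \<beta>_def interior_atLeastAtMost_real algebra_simps)
  then have below: "\<alpha> + \<beta> * x \<le> f x" if "x \<in> {0..1}" for x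
    using Vex_le[OF that] that by force
  have max: "\<alpha>' + \<beta>' * x0 \<le> \<alpha> + \<beta> * x0" if "\<And>x. x \<in> {0..1} \<Longrightarrow> \<alpha>' + \<beta>' * x \<le> f x" for \<alpha>' \<beta>'
    using le_Vex[of \<alpha>' \<beta>' x0] that x0 by (simp add: \<alpha>_def)
  have touch: "x \<in> {0..k1} \<union> {k2..1}" if "x \<in> {0..1}" "f x = \<alpha> + \<beta> * x" for x
    using vex[OF that(1)] below_Vex[OF that(1)] Vex_le[OF that(1)] that(2) by simp
  obtain y where y: "y \<in> {0..x0}" "f y = \<alpha> + \<beta> * y"
    using maximal_line_touches_left[OF f _ x0(4) below max] x0 by auto
  obtain z where z: "z \<in> {x0..1}" "f z = \<alpha> + \<beta> * z"
    using maximal_line_touches_right[OF f x0(3) _ below max] x0 by auto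
  have y': "y \<in> {0..1}" "y \<le> k1" using touch[of y] y x0 by auto
  have z': "z \<in> {0..1}" "k2 \<le> z" using touch[of z] z x0 by auto
  have fk: "f k1 = \<alpha> + \<beta> * k1" "f k2 = \<alpha> + \<beta> * k2"
    using touching_affine_on_segment[OF below y'(1) z'(1) y(2) z(2), of k1]
      touching_affine_on_segment[OF below y'(1) z'(1) y(2) z(2), of k2] y' z' k vex[of k1] vex[of k2] by auto
  have "x \<in> {k1, k2}" if "x \<in> {0..1}" "f x = \<alpha> + \<beta> * x" for x
  proof (rule ccontr)
    assume "x \<notin> {k1, k2}"
    then have x: "x \<in> {0..<k1} \<union> {k2<..1}" using touch[OF that] by auto
    have "k1 \<in> {0..1}" using k by auto
    from not_affine_near[OF x this _ below that(2) fk(1)] \<open>x \<notin> {k1, k2}\<close> show False by auto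
  qed
  then have "f x = \<alpha> + \<beta> * x \<longleftrightarrow> x \<in> {k1, k2}" if "x \<in> {0..1}" for x
    using that fk by blast
  with below show ?thesis by blast
qed

end

section \<open>Cost and optimality\<close>

context path_martingale
begin

text \<open>By right continuity the value at a time is the limit of values at dyadic grid points to
  its right, and each approximation reads only countably many coordinates.\<close>

lemma evaluation_measurable:
  "(\<lambda>z. snd z (fst z)) \<in> borel_measurable (lborel \<Otimes>\<^sub>M P)"
proof (rule borel_measurable_LIMSEQ_real)
  \<comment> \<open>The \<open>+ 1\<close> places the grid point strictly to the right of
    \<open>s\<close>, as convergence along \<open>at_right\<close> demands.\<close>
  let ?g = "\<lambda>n (s::real). real_of_int (\<lfloor>s * 2 ^ n\<rfloor> + 1) / 2 ^ n"
  show "(\<lambda>z. snd z (?g n (fst z))) \<in> borel_measurable (lborel \<Otimes>\<^sub>M P)" for n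
  proof (rule measurable_compose_countable[where f = "\<lambda>i z. snd z (real_of_int (i + 1) / 2 ^ n)"
        and g = "\<lambda>z. \<lfloor>(fst z :: real) * 2 ^ n\<rfloor>"])
    show "(\<lambda>z. \<lfloor>(fst z :: real) * 2 ^ n\<rfloor>) \<in> measurable (lborel \<Otimes>\<^sub>M P) (count_space UNIV)"
      by measurable
    show "(\<lambda>z. snd z (real_of_int (i + 1) / 2 ^ n)) \<in> borel_measurable (lborel \<Otimes>\<^sub>M P)" for i
      by (rule measurable_compose[OF measurable_snd coord_measurable])
  qed
  fix z :: "real \<times> (real \<Rightarrow> real)" assume "z \<in> space (lborel \<Otimes>\<^sub>M P)"
  then have w: "snd z \<in> path_space T t0" by (auto simp: space_pair_measure space_P)
  let ?s = "fst z"
  have gt: "?s < ?g n ?s" and le: "?g n ?s \<le> ?s + 1 / 2 ^ n" for n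
  proof -
    have "?s * 2 ^ n < real_of_int (\<lfloor>?s * 2 ^ n\<rfloor> + 1)" "real_of_int (\<lfloor>?s * 2 ^ n\<rfloor> + 1) \<le> ?s * 2 ^ n + 1"
      by linarith+
    then show "?s < ?g n ?s" "?g n ?s \<le> ?s + 1 / 2 ^ n"
      by (simp_all add: field_simps)
  qed
  have "(\<lambda>n. ?g n ?s) \<longlonglongrightarrow> ?s"
  proof (rule tendsto_sandwich[where f = "\<lambda>_. ?s" and h = "\<lambda>n. ?s + 1 / 2 ^ n"])
    show "(\<lambda>n. ?s + 1 / 2 ^ n) \<longlonglongrightarrow> ?s"
      using tendsto_add[OF tendsto_const[of ?s] LIMSEQ_divide_realpow_zero[of 2 1]] by simp
    show "\<forall>\<^sub>F n in sequentially. ?s \<le> ?g n ?s"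
      by (intro always_eventually allI less_imp_le gt)
    show "\<forall>\<^sub>F n in sequentially. ?g n ?s \<le> ?s + 1 / 2 ^ n"
      by (intro always_eventually allI le)
  qed simp
  then have "filterlim (\<lambda>n. ?g n ?s) (at_right ?s) sequentially"
    using gt less_imp_neq[OF gt, THEN not_sym] by (simp add: filterlim_at)
  moreover have "(snd z \<longlongrightarrow> snd z ?s) (at_right ?s)"
    using w by (simp add: path_space_def cadlag_def)
  ultimately show "(\<lambda>n. snd z (?g n ?s)) \<longlonglongrightarrow> snd z ?s"
    by (rule filterlim_compose[rotated])
qed

context
  fixes H :: "real \<Rightarrow> real \<Rightarrow> real"
  assumes H: "continuous_on ({t0..T} \<times> {0..1}) (\<lambda>(t, p). H t p)"
begin

lemma cost_measurable:
  "(\<lambda>z. indicator {t0..T} (fst z) * H (fst z) (snd z (fst z))) \<in> borel_measurable (lborel \<Otimes>\<^sub>M P)"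
proof -
  let ?A = "{t0..T} \<times> {0..1::real}"
  have "(\<lambda>x. indicator ?A x *\<^sub>R (case x of (t, p) \<Rightarrow> H t p)) \<in> borel_measurable borel"
    by (rule borel_measurable_continuous_on_indicator[OF _ H]) (auto intro: borel_closed closed_Times)
  then have "(\<lambda>x. indicator ?A x *\<^sub>R (case x of (t, p) \<Rightarrow> H t p)) \<in> borel_measurable (borel \<Otimes>\<^sub>M borel)"
    by (simp add: borel_prod)
  moreover have "(\<lambda>z. (fst z, snd z (fst z))) \<in> measurable (lborel \<Otimes>\<^sub>M P) (borel \<Otimes>\<^sub>M borel)"
    using evaluation_measurable by (intro measurable_Pair) auto
  ultimately have "(\<lambda>z. indicator ?A (fst z, snd z (fst z)) *\<^sub>R (case (fst z, snd z (fst z)) of (t, p) \<Rightarrow> H t p))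
      \<in> borel_measurable (lborel \<Otimes>\<^sub>M P)"
    by (rule measurable_compose[rotated])
  then show ?thesis
    by (rule measurable_cong[THEN iffD1, rotated])
      (auto simp: space_pair_measure space_P coord_bounds split: split_indicator)
qed

lemma cost_integrable:
  "integrable (lborel \<Otimes>\<^sub>M P) (\<lambda>z. indicator {t0..T} (fst z) * H (fst z) (snd z (fst z)))"
proof -
  have "bounded ((\<lambda>(t, p). H t p) ` ({t0..T} \<times> {0..1}))"
    using H by (intro compact_imp_bounded compact_continuous_image compact_Times) auto
  then obtain C where C': "\<forall>y\<in>(\<lambda>(t, p). H t p) ` ({t0..T} \<times> {0..1}). norm y \<le> C"
    unfolding bounded_iff by blast
  have C: "\<bar>H t p\<bar> \<le> C" if "t \<in> {t0..T}" "p \<in> {0..1}" for t p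
    using bspec[OF C' imageI[of "(t, p)"]] that by simp
  have A: "{t0..T} \<times> space P \<in> sets (lborel \<Otimes>\<^sub>M P)" by auto
  have "emeasure (lborel \<Otimes>\<^sub>M P) ({t0..T} \<times> space P) = emeasure lborel {t0..T} * emeasure P (space P)"
    by (rule emeasure_pair_measure_Times) auto
  then have "emeasure (lborel \<Otimes>\<^sub>M P) ({t0..T} \<times> space P) < \<infinity>"
    by (simp add: emeasure_space_1 emeasure_lborel_Icc_eq)
  then have "integrable (lborel \<Otimes>\<^sub>M P) (\<lambda>z. C * indicator ({t0..T} \<times> space P) z)"
    using A by simp
  then show ?thesis
  proof (rule Bochner_Integration.integrable_bound[OF _ cost_measurable])
    show "AE z in lborel \<Otimes>\<^sub>M P. norm (indicator {t0..T} (fst z) * H (fst z) (snd z (fst z)))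
        \<le> norm (C * indicator ({t0..T} \<times> space P) z)"
    proof (rule AE_I2)
      fix z :: "real \<times> (real \<Rightarrow> real)" assume "z \<in> space (lborel \<Otimes>\<^sub>M P)"
      then have z: "snd z \<in> path_space T t0" by (auto simp: space_pair_measure space_P)
      show "norm (indicator {t0..T} (fst z) * H (fst z) (snd z (fst z)))
          \<le> norm (C * indicator ({t0..T} \<times> space P) z)"
      proof (cases "fst z \<in> {t0..T}")
        case True
        then have "\<bar>H (fst z) (snd z (fst z))\<bar> \<le> C"
          using coord_bounds[OF z, of "fst z"] by (intro C) auto
        then show ?thesis
          using True z by (simp add: indicator_def space_P mem_Times_iff)
      qed simp
    qed
  qed
qed

definition running_cost :: "real \<Rightarrow> real" where
  "running_cost s = (\<integral>w. indicator {t0..T} s * H s (w s) \<partial>P)"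

lemma expected_cost_eq: "expected_cost H T t0 P = (\<integral>s. running_cost s \<partial>lborel)"
  and running_cost_integrable: "integrable lborel running_cost"
proof -
  interpret pair_sigma_finite lborel P ..
  have i: "integrable (lborel \<Otimes>\<^sub>M P) (\<lambda>(s, w). indicator {t0..T} s * H s (w s))"
    unfolding case_prod_beta' by (rule cost_integrable)
  show "expected_cost H T t0 P = (\<integral>s. running_cost s \<partial>lborel)"
    unfolding expected_cost_def running_cost_def set_lebesgue_integral_def real_scaleR_def
    by (rule Fubini_integral[OF i])
  show "integrable lborel running_cost"
    unfolding running_cost_def[abs_def] using integrable_fst[OF i] .
qed

lemma H_coord_integrable:
  assumes s: "s \<in> {t0..T}"
  shows "integrable P (\<lambda>w. H s (w s))"
proof -
  have c: "continuous_on {0..1} (H s)"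
  proof -
    have "continuous_on {0..1} ((\<lambda>(t, p). H t p) \<circ> Pair s)"
      using s by (intro continuous_on_compose continuous_intros continuous_on_subset[OF H]) auto
    then show ?thesis by (simp add: comp_def)
  qed
  have "bounded (H s ` {0..1})"
    using c by (intro compact_imp_bounded compact_continuous_image) auto
  then obtain C where "\<forall>y\<in>H s ` {0..1}. norm y \<le> C"
    unfolding bounded_iff by blast
  then have C: "\<bar>H s p\<bar> \<le> C" if "p \<in> {0..1}" for p
    using that by (metis imageI real_norm_def)
  show ?thesis
  proof (rule integrable_const_bound[of _ C])
    show "AE w in P. norm (H s (w s)) \<le> C"
      using AE_path_space
    proof eventually_elim
      case (elim w)
      then show ?case using coord_bounds[OF elim, of s] by (simp add: C)
    qed
    have "(\<lambda>p. indicator {0..1} p *\<^sub>R H s p) \<in> borel_measurable borel"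
      by (rule borel_measurable_continuous_on_indicator[OF _ c]) auto
    from measurable_compose[OF coord_measurable[of s] this]
    have *: "(\<lambda>w. indicator {0..1} (w s) *\<^sub>R H s (w s)) \<in> borel_measurable P" .
    have eq: "indicator {0..1} (w s) *\<^sub>R H s (w s) = H s (w s)" if "w \<in> space P" for w
      using coord_bounds[of w s] that by (simp add: space_P)
    show "(\<lambda>w. H s (w s)) \<in> borel_measurable P"
      using * by (subst (asm) measurable_cong[OF eq])
  qed
qed

text \<open>Since the process has mean \<open>p0\<close>, the running cost exceeds the value of a minorizing line at
  \<open>p0\<close> by the expected gap, which vanishes only on the contact set.\<close>

lemma running_cost_lower_bound:
  assumes s: "s \<in> {t0..T}" and below: "\<And>x. x \<in> {0..1} \<Longrightarrow> \<alpha> + \<beta> * x \<le> H s x"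
    and contact: "\<And>x. x \<in> {0..1} \<Longrightarrow> H s x = \<alpha> + \<beta> * x \<longleftrightarrow> x \<in> C"
  shows "\<alpha> + \<beta> * p0 \<le> running_cost s"
    and "running_cost s = \<alpha> + \<beta> * p0 \<longleftrightarrow> (AE w in P. w s \<in> C)"
proof -
  let ?gap = "\<lambda>w. H s (w s) - (\<alpha> + \<beta> * w s)"
  have "integrable P (\<lambda>w. 1 * w s)"
    by (rule integral_mult_coord(1)[OF order_refl]) auto
  then have ci: "integrable P (\<lambda>w. w s)"
    by simp
  have gi: "integrable P ?gap"
    using H_coord_integrable[OF s] ci by simp
  have eq: "running_cost s = \<alpha> + \<beta> * p0 + (\<integral>w. ?gap w \<partial>P)"
  proof -
    have "running_cost s = (\<integral>w. (\<alpha> + \<beta> * w s) + ?gap w \<partial>P)"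
      using s by (simp add: running_cost_def)
    also have "\<dots> = (\<integral>w. \<alpha> + \<beta> * w s \<partial>P) + (\<integral>w. ?gap w \<partial>P)"
      by (rule Bochner_Integration.integral_add[OF _ gi]) (use ci in simp)
    also have "(\<integral>w. \<alpha> + \<beta> * w s \<partial>P) = \<alpha> + \<beta> * p0"
      using ci integral_coord[of s] by (simp add: prob_space)
    finally show ?thesis .
  qed
  have nonneg: "AE w in P. 0 \<le> ?gap w"
    using AE_path_space
  proof eventually_elim
    case (elim w)
    then show ?case using below[of "w s"] coord_bounds[OF elim, of s] by simp
  qed
  show "\<alpha> + \<beta> * p0 \<le> running_cost s"
    unfolding eq using integral_nonneg_AE[OF nonneg] by simp
  have "(\<integral>w. ?gap w \<partial>P) = 0 \<longleftrightarrow> (AE w in P. ?gap w = 0)"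
    by (rule integral_nonneg_eq_0_iff_AE[OF gi nonneg])
  also have "\<dots> \<longleftrightarrow> (AE w in P. w s \<in> C)"
  proof (rule AE_cong)
    fix w assume "w \<in> space P"
    then have "w s \<in> {0..1}" using coord_bounds[of w s] by (simp add: space_P)
    from contact[OF this] show "?gap w = 0 \<longleftrightarrow> w s \<in> C" by simp
  qed
  finally show "running_cost s = \<alpha> + \<beta> * p0 \<longleftrightarrow> (AE w in P. w s \<in> C)"
    unfolding eq by simp
qed

end

end

lemma AE_lborel_interval_obtain:
  assumes "AE s in lborel. Q s" "c < (d :: real)"
  obtains s where "c < s" "s < d" "Q s"
proof (rule ccontr)
  assume "\<not> thesis"
  then have no: "\<And>s. c < s \<Longrightarrow> s < d \<Longrightarrow> \<not> Q s" using that by blast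
  have "AE s in lborel. s \<notin> {c<..<d}"
    using assms(1) by eventually_elim (use no in auto)
  then have "{c<..<d} \<in> null_sets lborel"
    by (subst AE_iff_null_sets) auto
  then show False
    using assms(2) by (auto simp: null_sets_def)
qed

text \<open>A given time may be exceptional, but every interval to its right contains good times. A
  sequence of them decreasing to it shares one null set, and right continuity does the rest; outside
  \<open>[t0, T)\<close> the boundary conditions apply.\<close>

lemma (in path_martingale) two_point_martingale_of_AE_time:
  assumes "terminal_corridor a b p0 T t0"
    and ae: "AE s in lborel. t0 < s \<longrightarrow> s < T \<longrightarrow> (AE w in P. w s \<in> {a s, b s})"
  shows "two_point_martingale a b p0 T t0 P"
proof -
  interpret terminal_corridor a b p0 T t0 by fact
  have "AE w in P. w t \<in> {a t, b t}" for t
  proof -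
    consider "t < t0" | "T \<le> t" | "t0 \<le> t" "t < T" by linarith
    then show ?thesis
    proof cases
      case 1
      have "AE w in P. \<forall>t<t0. w t = p0"
        using P by (auto simp: martingale_measures_def)
      then show ?thesis
        by eventually_elim (use 1 ab_initial in auto)
    next
      case 2
      have "AE w in P. \<forall>t\<ge>T. w t \<in> {0, 1}"
        using P by (auto simp: martingale_measures_def)
      then show ?thesis
        by eventually_elim (use 2 terminal in auto)
    next
      case 3
      have "\<exists>s. t < s \<and> s < min T (t + 1 / Suc n) \<and> (AE w in P. w s \<in> {a s, b s})" for n
      proof -
        have "t < min T (t + 1 / Suc n)" using 3 by simp
        from AE_lborel_interval_obtain[OF ae this] obtain s
          where "t < s" "s < min T (t + 1 / Suc n)" "t0 < s \<longrightarrow> s < T \<longrightarrow> (AE w in P. w s \<in> {a s, b s})" .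
        then show ?thesis using 3 by (intro exI[of _ s]) auto
      qed
      then obtain r where r: "\<And>n. t < r n" "\<And>n. r n < min T (t + 1 / Suc n)"
          "\<And>n. AE w in P. w (r n) \<in> {a (r n), b (r n)}"
        by metis
      have "r \<longlonglongrightarrow> t"
      proof (rule tendsto_sandwich[where f = "\<lambda>_. t" and h = "\<lambda>n. t + 1 / real (Suc n)"])
        show "(\<lambda>n. t + 1 / real (Suc n)) \<longlonglongrightarrow> t"
          using tendsto_add[OF tendsto_const[of t] LIMSEQ_inverse_real_of_nat] by (simp add: inverse_eq_divide)
        have "r n \<le> t + 1 / real (Suc n)" for n using r(2)[of n] by simp
        then show "\<forall>\<^sub>F n in sequentially. r n \<le> t + 1 / real (Suc n)"
          by (intro always_eventually allI)
        show "\<forall>\<^sub>F n in sequentially. t \<le> r n"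
          by (intro always_eventually allI less_imp_le r(1))
      qed simp
      moreover have "r n \<in> {t<..}" "r n \<noteq> t" for n
        using r(1)[of n] by auto
      ultimately have lim: "filterlim r (at_right t) sequentially"
        by (simp add: filterlim_at)
      have "AE w in P. \<forall>n. w (r n) \<in> {a (r n), b (r n)}"
        unfolding AE_all_countable using r(3) by blast
      with AE_path_space show ?thesis
      proof eventually_elim
        case (elim w)
        have "\<exists>\<^sub>F s in at_right t. w s \<in> {a s, b s}"
          unfolding frequently_def
        proof
          assume "\<forall>\<^sub>F s in at_right t. w s \<notin> {a s, b s}"
          with lim have "\<forall>\<^sub>F n in sequentially. w (r n) \<notin> {a (r n), b (r n)}"
            unfolding filterlim_iff by blast
          then show False
            using elim(2) by (auto simp: eventually_sequentially)
        qed
        then show ?case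
          using elim a_right b_right
          by (intro right_limit_two_point) (auto simp: path_space_def cadlag_def)
      qed
    qed
  qed
  then show ?thesis
    by (intro two_point_martingale.intro two_point_martingale_axioms.intro
        \<open>terminal_corridor a b p0 T t0\<close> path_martingale_axioms)
qed

text \<open>\<open>law\<close> attains the value of the line at \<open>p0\<close>, so it minimizes
  the running cost at each single time, not just after integration. A competitor with the same total
  cost must therefore agree with it at almost every time.\<close>

lemma (in terminal_corridor) optimal_iff_law:
  assumes H: "continuous_on ({t0..T} \<times> {0..1}) (\<lambda>(t, p). H t p)" and t0T: "t0 < T"
    and lines: "\<And>s. t0 < s \<Longrightarrow> s < T \<Longrightarrow> \<exists>\<alpha> \<beta>. \<forall>x\<in>{0..1}. \<alpha> + \<beta> * x \<le> H s x \<and>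
      (H s x = \<alpha> + \<beta> * x \<longleftrightarrow> x \<in> {a s, b s})"
  shows "optimal_martingale_measure H T t0 p0 Q \<longleftrightarrow> Q = law"
proof -
  interpret L: path_martingale T t0 p0 law
    by standard (rule law_martingale_measure)
  interpret LL: two_point_martingale a b p0 T t0 law
    by standard (rule AE_law_two_point)
  have outside: "path_martingale.running_cost T t0 Q H s = 0"
    if "Q \<in> martingale_measures T t0 p0" "s \<notin> {t0..T}" for Q s
    using that path_martingale.running_cost_def[OF path_martingale.intro[OF that(1)] H] by simp
  have cmp: "L.running_cost H s \<le> path_martingale.running_cost T t0 Q H s"
      "path_martingale.running_cost T t0 Q H s = L.running_cost H s \<longleftrightarrow> (AE w in Q. w s \<in> {a s, b s})"
    if Q: "Q \<in> martingale_measures T t0 p0" and s: "t0 < s" "s < T" for Q s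
  proof -
    interpret Q: path_martingale T t0 p0 Q by standard (rule Q)
    obtain \<alpha> \<beta> where l: "\<And>x. x \<in> {0..1} \<Longrightarrow> \<alpha> + \<beta> * x \<le> H s x"
        "\<And>x. x \<in> {0..1} \<Longrightarrow> H s x = \<alpha> + \<beta> * x \<longleftrightarrow> x \<in> {a s, b s}"
      using lines[OF s] by blast
    have s': "s \<in> {t0..T}" using s by auto
    have "L.running_cost H s = \<alpha> + \<beta> * p0"
      using L.running_cost_lower_bound(2)[OF H s' l] AE_law_two_point by blast
    then show "L.running_cost H s \<le> Q.running_cost H s"
      "Q.running_cost H s = L.running_cost H s \<longleftrightarrow> (AE w in Q. w s \<in> {a s, b s})"
      using Q.running_cost_lower_bound[OF H s' l] by simp_all
  qed
  have ae_le: "AE s in lborel. L.running_cost H s \<le> path_martingale.running_cost T t0 Q H s"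
    if Q: "Q \<in> martingale_measures T t0 p0" for Q
    using AE_lborel_singleton[of t0] AE_lborel_singleton[of T]
  proof eventually_elim
    case (elim s)
    then show ?case
      using cmp(1)[OF Q, of s] outside[OF Q, of s] outside[OF law_martingale_measure, of s]
      by (cases "s \<in> {t0..T}") auto
  qed
  have optimal: "expected_cost H T t0 law \<le> expected_cost H T t0 Q"
    if Q: "Q \<in> martingale_measures T t0 p0" for Q
  proof -
    interpret Q: path_martingale T t0 p0 Q by standard (rule Q)
    show ?thesis
      unfolding L.expected_cost_eq[OF H] Q.expected_cost_eq[OF H]
      by (rule integral_mono_AE[OF L.running_cost_integrable[OF H] Q.running_cost_integrable[OF H] ae_le[OF Q]])
  qed
  show ?thesis
  proof
    assume "Q = law"
    then show "optimal_martingale_measure H T t0 p0 Q"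
      using optimal law_martingale_measure by (simp add: optimal_martingale_measure_def)
  next
    assume opt: "optimal_martingale_measure H T t0 p0 Q"
    then have Q: "Q \<in> martingale_measures T t0 p0"
      by (simp add: optimal_martingale_measure_def)
    interpret Q: path_martingale T t0 p0 Q by standard (rule Q)
    have "expected_cost H T t0 Q = expected_cost H T t0 law"
      using opt optimal[OF Q] law_martingale_measure by (auto simp: optimal_martingale_measure_def intro: antisym)
    then have "(\<integral>s. Q.running_cost H s - L.running_cost H s \<partial>lborel) = 0"
      unfolding L.expected_cost_eq[OF H] Q.expected_cost_eq[OF H]
      using L.running_cost_integrable[OF H] Q.running_cost_integrable[OF H] by simp
    moreover have "AE s in lborel. 0 \<le> Q.running_cost H s - L.running_cost H s"
      using ae_le[OF Q] by eventually_elim simp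
    ultimately have "AE s in lborel. Q.running_cost H s - L.running_cost H s = 0"
      using L.running_cost_integrable[OF H] Q.running_cost_integrable[OF H]
      by (subst integral_nonneg_eq_0_iff_AE[symmetric]) auto
    then have "AE s in lborel. t0 < s \<longrightarrow> s < T \<longrightarrow> (AE w in Q. w s \<in> {a s, b s})"
    proof eventually_elim
      case (elim s)
      then show ?case using cmp(2)[OF Q, of s] by auto
    qed
    then have "two_point_martingale a b p0 T t0 Q"
      by (rule Q.two_point_martingale_of_AE_time[OF terminal_corridor_axioms])
    then show "Q = law"
      by (rule two_point_martingale_unique) (rule LL.two_point_martingale_axioms)
  qed
qed

section \<open>The entrance time and the corridor of the theorem\<close>

text \<open>Both boundaries of the corridor have this form. Each piece contains its left end point,
  so right limits never cross a switch.\<close>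

lemma right_continuous_switch:
  fixes h :: "real \<Rightarrow> real"
  assumes h: "continuous_on {0..T} h" and ts: "0 \<le> ts" "ts \<le> T"
  shows "((\<lambda>t. if T \<le> t then e else if ts \<le> t then h t else p) \<longlongrightarrow>
    (if T \<le> t then e else if ts \<le> t then h t else p)) (at_right t)"
proof -
  let ?c = "\<lambda>t. if T \<le> t then e else if ts \<le> t then h t else p"
  have right: "\<forall>\<^sub>F r in at_right t. t < r"
    by (simp add: eventually_at_filter)
  have before: "\<forall>\<^sub>F r in at_right t. r < u" if "t < u" for u
    using eventually_at_right_real[OF that] by eventually_elim auto
  consider "T \<le> t" | "ts \<le> t" "t < T" | "t < ts" by linarith
  then show ?thesis
  proof cases
    case 1
    have "\<forall>\<^sub>F r in at_right t. ?c r = ?c t"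
      using right by eventually_elim (use 1 in auto)
    then show ?thesis by (rule tendsto_eventually)
  next
    case 2
    have "(h \<longlongrightarrow> h t) (at t within {0..T})"
      using h 2 ts by (auto simp: continuous_on_def)
    then have "(h \<longlongrightarrow> h t) (at t within {t..T})"
      by (rule tendsto_within_subset) (use 2 ts in auto)
    then have "(h \<longlongrightarrow> h t) (at_right t)"
      using 2 by (simp add: at_within_Icc_at_right)
    moreover have "\<forall>\<^sub>F r in at_right t. h r = ?c r"
      using right before[OF 2(2)] by eventually_elim (use 2 in auto)
    ultimately have "(?c \<longlongrightarrow> h t) (at_right t)"
      by (rule Lim_transform_eventually)
    then show ?thesis using 2 by simp
  next
    case 3
    have "\<forall>\<^sub>F r in at_right t. ?c r = ?c t"
      using before[OF 3] by eventually_elim (use 3 ts in auto)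
    then show ?thesis by (rule tendsto_eventually)
  qed
qed

text \<open>The set of admissible times is closed by continuity, so it contains its infimum, and it
  persists to the right because \<open>[h1, h2]\<close> grows. The equivalence stops before
  \<open>T\<close>, since the value \<open>T\<close> also stands for the empty set.\<close>

lemma t_star_properties:
  assumes t0: "t0 \<in> {0..<T}" and h: "continuous_on {0..T} h1" "continuous_on {0..T} h2"
    and anti: "\<And>s t. \<lbrakk>s \<in> {0..T}; t \<in> {0..T}; s \<le> t\<rbrakk> \<Longrightarrow> h1 t \<le> h1 s"
    and mono: "\<And>s t. \<lbrakk>s \<in> {0..T}; t \<in> {0..T}; s \<le> t\<rbrakk> \<Longrightarrow> h2 s \<le> h2 t"
  shows "t_star h1 h2 T t0 p0 \<in> {t0..T}"
    and "\<lbrakk>t0 \<le> t; t < T\<rbrakk> \<Longrightarrow> p0 \<in> {h1 t..h2 t} \<longleftrightarrow> t_star h1 h2 T t0 p0 \<le> t"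
proof -
  define S where "S = {t\<in>{t0..T}. p0 \<in> {h1 t..h2 t}}"
  have ts: "t_star h1 h2 T t0 p0 = (if S = {} then T else Inf S)"
    unfolding t_star_def S_def Let_def ..
  have bdd: "bdd_below S" unfolding S_def by (intro bdd_belowI[of _ t0]) auto
  have "S = {t\<in>{t0..T}. h1 t \<le> p0} \<inter> {t\<in>{t0..T}. p0 \<le> h2 t}"
    unfolding S_def by auto
  moreover have "closed {t\<in>{t0..T}. h1 t \<le> p0}" "closed {t\<in>{t0..T}. p0 \<le> h2 t}"
    using t0 by (intro continuous_on_closed_Collect_le continuous_on_const closed_atLeastAtMost
      continuous_on_subset[OF h(1)] continuous_on_subset[OF h(2)]; simp)+
  ultimately have closed: "closed S" by auto
  have Inf: "Inf S \<in> S" if "S \<noteq> {}"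
    by (rule closed_contains_Inf[OF that bdd closed])
  show range: "t_star h1 h2 T t0 p0 \<in> {t0..T}"
    using Inf t0 by (auto simp: ts S_def)
  assume t: "t0 \<le> t" "t < T"
  show "p0 \<in> {h1 t..h2 t} \<longleftrightarrow> t_star h1 h2 T t0 p0 \<le> t"
  proof
    assume "p0 \<in> {h1 t..h2 t}"
    then have "t \<in> S" using t by (auto simp: S_def)
    then show "t_star h1 h2 T t0 p0 \<le> t" using cInf_lower[OF _ bdd] by (auto simp: ts)
  next
    assume le: "t_star h1 h2 T t0 p0 \<le> t"
    then have ne: "S \<noteq> {}" using t by (auto simp: ts)
    with le have "Inf S \<le> t" by (simp add: ts)
    moreover have "Inf S \<in> {t0..T}" "h1 (Inf S) \<le> p0" "p0 \<le> h2 (Inf S)"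
      using Inf[OF ne] by (auto simp: S_def)
    ultimately show "p0 \<in> {h1 t..h2 t}"
      using anti[of "Inf S" t] mono[of "Inf S" t] t t0 by auto
  qed
qed

theorem proposition4p7:
  fixes T t0 p0 :: real
    and U :: "'u::euclidean_space set" and V :: "'v::euclidean_space set"
    and l1 l2 :: "real \<Rightarrow> 'u \<Rightarrow> 'v \<Rightarrow> real"
    and h1 h2 :: "real \<Rightarrow> real"
  assumes "0 < T"
    and "compact U" "U \<noteq> {}" "compact V" "V \<noteq> {}"
    and "continuous_on ({0..T} \<times> U \<times> V) (\<lambda>(t, u, v). l1 t u v)"
    and "continuous_on ({0..T} \<times> U \<times> V) (\<lambda>(t, u, v). l2 t u v)"
    and "isaacs_condition T l1 l2 U V"
    and "continuous_on {0..T} h1" "continuous_on {0..T} h2"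
    and "h1 ` {0..T} \<subseteq> {0..1}" "h2 ` {0..T} \<subseteq> {0..1}"
    and "\<forall>t\<in>{0..T}. h1 t \<le> h2 t"
    and "strict_antimono_on {0..T} h1" "strict_mono_on {0..T} h2"
    and "\<forall>t\<in>{0..T}. \<forall>p\<in>{0..1}.
           Vex (hamiltonian l1 l2 U V t) p = hamiltonian l1 l2 U V t p \<longleftrightarrow>
           p \<in> {0..h1 t} \<union> {h2 t..1}"
    and "\<forall>t\<in>{0..T}. \<forall>p\<in>{0..<h1 t} \<union> {h2 t<..1}.
           \<exists>d>0. has_second_derivative_within (hamiltonian l1 l2 U V t) d p {0..1}"
    and "t0 \<in> {0..<T}" "p0 \<in> {0..1}"
  shows "\<exists>P.
    optimal_martingale_measure (hamiltonian l1 l2 U V) T t0 p0 P \<and>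
    (\<forall>Q. optimal_martingale_measure (hamiltonian l1 l2 U V) T t0 p0 Q \<longrightarrow> Q = P) \<and>
    purely_discontinuous P (path_filtration T t0) t0 (\<lambda>t w. w t) \<and>
    (AE w in P. \<forall>t\<in>{t0..t_star h1 h2 T t0 p0}. (w \<longlongrightarrow> p0) (at_left t)) \<and>
    (AE w in P. \<forall>t\<in>{t_star h1 h2 T t0 p0..<T}. w t \<in> {h1 t, h2 t}) \<and>
    (\<forall>s t. t_star h1 h2 T t0 p0 \<le> s \<and> s \<le> t \<and> t < T \<and>
           0 < \<P>(w in P. w s = h1 s) \<and> h1 t < h2 t \<longrightarrow>
           \<P>(w in P. w t = h1 t \<bar> w s = h1 s) = (h2 t - h1 s) / (h2 t - h1 t))"
proof -
  let ?H = "hamiltonian l1 l2 U V"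
  define ts where "ts = t_star h1 h2 T t0 p0"
  have h1_strict: "h1 t < h1 s" and h2_strict: "h2 s < h2 t" if "0 \<le> s" "s < t" "t \<le> T" for s t
    using assms(14,15) that by (auto simp: monotone_on_def)
  have anti: "h1 t \<le> h1 s" and mono: "h2 s \<le> h2 t" if "s \<in> {0..T}" "t \<in> {0..T}" "s \<le> t" for s t
    using h1_strict[of s t] h2_strict[of s t] that by (cases "s = t"; auto)+
  have h01: "0 \<le> h1 t" "h1 t \<le> h2 t" "h2 t \<le> 1" if "t \<in> {0..T}" for t
    using assms(11-13) that by (auto simp: image_subset_iff)
  have t0: "0 \<le> t0" "t0 < T" using assms(18) by auto
  have ts: "t0 \<le> ts" "ts \<le> T"
    using t_star_properties(1)[OF assms(18,9,10) anti mono] by (auto simp: ts_def)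
  have ts_iff: "p0 \<in> {h1 t..h2 t} \<longleftrightarrow> ts \<le> t" if "t0 \<le> t" "t < T" for t
    unfolding ts_def by (rule t_star_properties(2)[OF assms(18,9,10) anti mono that])
  have p0_between: "h1 t \<le> p0" "p0 \<le> h2 t" if "ts \<le> t" "t < T" for t
    using ts_iff[of t] ts that by auto
  \<comment> \<open>The test against \<open>T\<close> comes first, so the middle piece is void when
    \<open>ts = T\<close>, in particular when \<open>p0\<close> never enters.\<close>
  define a where "a t = (if T \<le> t then 0 else if ts \<le> t then h1 t else p0)" for t
  define b where "b t = (if T \<le> t then 1 else if ts \<le> t then h2 t else p0)" for t
  interpret terminal_corridor a b p0 T t0
  proof
    fix s t :: real assume "s \<le> t"
    then show "a t \<le> a s" "b s \<le> b t"
      using anti[of s t] mono[of s t] p0_between h01 ts t0 assms(19)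
      by (auto simp: a_def b_def)
  next
    fix t :: real
    show "(a \<longlongrightarrow> a t) (at_right t)" "(b \<longlongrightarrow> b t) (at_right t)"
      unfolding a_def[abs_def] b_def[abs_def]
      using right_continuous_switch[OF assms(9), of ts] right_continuous_switch[OF assms(10), of ts] ts t0
      by auto
    show "a t \<le> p0" "p0 \<le> b t" "0 \<le> a t" "b t \<le> 1"
      using p0_between[of t] h01[of t] assms(19) ts t0 by (auto simp: a_def b_def)
    show "t < t0 \<Longrightarrow> a t = b t" "T \<le> t \<Longrightarrow> a t = 0" "T \<le> t \<Longrightarrow> b t = 1"
      using ts t0 by (auto simp: a_def b_def)
  qed
  interpret P: two_point_martingale a b p0 T t0 law
    by standard (rule law_martingale_measure, rule AE_law_two_point)
  have cont: "continuous_on ({0..T} \<times> {0..1}) (\<lambda>(t, p). ?H t p)"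
    using assms(2-7) by (intro continuous_on_hamiltonian)
  have lines: "\<exists>\<alpha> \<beta>. \<forall>x\<in>{0..1}. \<alpha> + \<beta> * x \<le> ?H s x \<and> (?H s x = \<alpha> + \<beta> * x \<longleftrightarrow> x \<in> {a s, b s})"
    if s: "t0 < s" "s < T" for s
  proof -
    have sT: "s \<in> {0..T}" using s t0 by auto
    have c: "continuous_on {0..1} (?H s)"
    proof -
      have "continuous_on {0..1} ((\<lambda>(t, p). ?H t p) \<circ> Pair s)"
        using sT by (intro continuous_on_compose continuous_intros continuous_on_subset[OF cont]) auto
      then show ?thesis by (simp add: comp_def)
    qed
    note vex = assms(16)[rule_format, OF sT] and d2 = assms(17)[rule_format, OF sT]
    show ?thesis
    proof (cases "ts \<le> s")
      case True
      \<comment> \<open>Strict monotonicity separates the boundaries at every time after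
        \<open>t0\<close>, even if they coincide at \<open>t0\<close>; the chord needs a
        nondegenerate interval.\<close>
      have "h1 s < h1 t0" "h2 t0 < h2 s" "h1 t0 \<le> h2 t0"
        using h1_strict[of t0 s] h2_strict[of t0 s] h01[of t0] s t0 by auto
      then have "h1 s < h2 s" by linarith
      from chord_line[OF c h01[OF sT] vex d2 this] show ?thesis
        using True s by (simp add: a_def b_def)
    next
      case False
      then have "p0 \<in> {0..<h1 s} \<union> {h2 s<..1}"
        using ts_iff[of s] s assms(19) by auto
      from tangent_line[OF c h01[OF sT] vex d2 this] show ?thesis
        using False s by (simp add: a_def b_def)
    qed
  qed
  have optimal: "optimal_martingale_measure ?H T t0 p0 Q \<longleftrightarrow> Q = law" for Q
    by (rule optimal_iff_law[OF continuous_on_subset[OF cont] t0(2) lines]) (use t0 in auto)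
  have "AE w in law. \<forall>t\<in>{t0..ts}. (w \<longlongrightarrow> p0) (at_left t)"
    using P.AE_two_point
  proof eventually_elim
    case (elim w)
    show ?case
    proof
      fix t assume t: "t \<in> {t0..ts}"
      have "\<forall>\<^sub>F r in at_left t. r < t"
        by (simp add: eventually_at_filter)
      then have "\<forall>\<^sub>F r in at_left t. w r = p0"
      proof eventually_elim
        case (elim r)
        then have "a r = p0" "b r = p0" using t ts by (auto simp: a_def b_def)
        then show ?case using \<open>\<forall>t. w t \<in> {a t, b t}\<close> by force
      qed
      then show "(w \<longlongrightarrow> p0) (at_left t)" by (rule tendsto_eventually)
    qed
  qed
  moreover have "AE w in law. \<forall>t\<in>{ts..<T}. w t \<in> {h1 t, h2 t}"
    using P.AE_two_point
  proof eventually_elim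
    case (elim w)
    show ?case
    proof
      fix t assume "t \<in> {ts..<T}"
      then have "a t = h1 t" "b t = h2 t" by (auto simp: a_def b_def)
      then show "w t \<in> {h1 t, h2 t}" using elim by metis
    qed
  qed
  moreover have "\<P>(w in law. w t = h1 t \<bar> w s = h1 s) = (h2 t - h1 s) / (h2 t - h1 t)"
    if "ts \<le> s" "s \<le> t" "t < T" "0 < \<P>(w in law. w s = h1 s)" "h1 t < h2 t" for s t
  proof -
    have "a s = h1 s" "a t = h1 t" "b t = h2 t" using that by (auto simp: a_def b_def)
    then show ?thesis using P.cond_prob_low[of s t] that by simp
  qed
  ultimately show ?thesis
    using optimal P.purely_discontinuous_coordinate unfolding ts_def
    by (intro exI[of _ law]) blast
qed

end
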